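(* There is an algorithm which, given a tournament $T$ on $n$ vertices and a nonnegative integer $k$, outputs a feedback arc set of $T$ of size at most $k$ if one exists (and otherwise reports that none exists), and whose running time is $2^{O(\sqrt{k})} n^{O(1)}$.
   Context: A tournament is a directed graph in which every pair of distinct vertices is joined by exactly one arc. A feedback arc set of a digraph is a set of arcs whose removal leaves an acyclic digraph. The problem $k$-FAST asks, given a tournament and a parameter $k$, to find a feedback arc set of size $k$ if one exists; the theorem asserts that $k$-FAST can be solved within the stated running time. *)

theory Defs
  imports Complex_Main "HOL-Library.Landau_Symbols"
begin

section \<open>Tournaments and feedback arc sets\<close>

definition tournament :: "'a set \<Rightarrow> ('a \<times> 'a) set \<Rightarrow> bool" where
  "tournament V A \<longleftrightarrow>
     finite V \<and> A \<subseteq> V \<times> V \<and> irrefl A \<and>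
     (\<forall>u\<in>V. \<forall>v\<in>V. u \<noteq> v \<longrightarrow> ((u, v) \<in> A \<longleftrightarrow> (v, u) \<notin> A))"

definition feedback_arc_set :: "('a \<times> 'a) set \<Rightarrow> ('a \<times> 'a) set \<Rightarrow> bool" where
  "feedback_arc_set A F \<longleftrightarrow> F \<subseteq> A \<and> acyclic (A - F)"

section \<open>The machine model\<close>

text \<open>
  Algorithms are programs of a first-order LISP-like language. The only data are binary trees,
  and the only primitives are building a pair, taking it apart, and testing for the atom; in
  particular there is no built-in arithmetic and no built-in equality of trees.

  Each evaluation step costs one unit. With values represented by pointers to (shared) cons
  cells, a step takes constant time (depending only on the program) on a RAM or pointer machine:
  the environment has a length bounded by the program, as it consists of the arguments of the
  current call and of the enclosing let-bound values. Conversely, a Turing machine is simulated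
  with constant overhead per step (a tape is a pair of lists). Thus running time is the usual
  one up to a polynomial, to which bounds of the form \<open>2\<^bsup>O(\<surd>k)\<^esup> n\<^bsup>O(1)\<^esup>\<close> are insensitive.
\<close>

datatype data = Atom | Cell data data

fun left :: "data \<Rightarrow> data" where
  "left Atom = Atom"
| "left (Cell x y) = x"

fun right :: "data \<Rightarrow> data" where
  "right Atom = Atom"
| "right (Cell x y) = y"

text \<open>Variables are de Bruijn indices into the environment; functions are called by number.\<close>

datatype exp =
    EVar nat
  | EAtom
  | EPair exp exp
  | ELeft exp
  | ERight exp
  | EIf exp exp exp
  | ELet exp exp
  | ECall nat "exp list"

type_synonym program = "exp list"

text \<open>
  \<open>eval P env e v t\<close>: in program \<open>P\<close> and environment \<open>env\<close>, the expression \<open>e\<close> evaluates to \<open>v\<close>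
  in exactly \<open>t\<close> steps. A diverging or stuck evaluation has no \<open>v\<close> and \<open>t\<close>.
\<close>

inductive eval :: "program \<Rightarrow> data list \<Rightarrow> exp \<Rightarrow> data \<Rightarrow> nat \<Rightarrow> bool"
  and evals :: "program \<Rightarrow> data list \<Rightarrow> exp list \<Rightarrow> data list \<Rightarrow> nat \<Rightarrow> bool"
  for P :: program
where
  eval_Var: "i < length env \<Longrightarrow> eval P env (EVar i) (env ! i) 1"
| eval_Atom: "eval P env EAtom Atom 1"
| eval_Pair: "eval P env e1 v1 t1 \<Longrightarrow> eval P env e2 v2 t2 \<Longrightarrow>
    eval P env (EPair e1 e2) (Cell v1 v2) (t1 + t2 + 1)"
| eval_Left: "eval P env e v t \<Longrightarrow> eval P env (ELeft e) (left v) (t + 1)"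
| eval_Right: "eval P env e v t \<Longrightarrow> eval P env (ERight e) (right v) (t + 1)"
| eval_If_Pair: "eval P env c (Cell x y) t1 \<Longrightarrow> eval P env e1 v t2 \<Longrightarrow>
    eval P env (EIf c e1 e2) v (t1 + t2 + 1)"
| eval_If_Atom: "eval P env c Atom t1 \<Longrightarrow> eval P env e2 v t2 \<Longrightarrow>
    eval P env (EIf c e1 e2) v (t1 + t2 + 1)"
| eval_Let: "eval P env e1 v1 t1 \<Longrightarrow> eval P (v1 # env) e2 v2 t2 \<Longrightarrow>
    eval P env (ELet e1 e2) v2 (t1 + t2 + 1)"
| eval_Call: "evals P env es vs t1 \<Longrightarrow> f < length P \<Longrightarrow> eval P vs (P ! f) v t2 \<Longrightarrow>
    eval P env (ECall f es) v (t1 + t2 + 1)"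
| evals_Nil: "evals P env [] [] 0"
| evals_Cons: "eval P env e v t1 \<Longrightarrow> evals P env es vs t2 \<Longrightarrow>
    evals P env (e # es) (v # vs) (t1 + t2)"

text \<open>Function \<open>0\<close> is the main function.\<close>

definition runs :: "program \<Rightarrow> data list \<Rightarrow> data \<Rightarrow> nat \<Rightarrow> bool" where
  "runs P inputs v t \<longleftrightarrow> P \<noteq> [] \<and> eval P inputs (P ! 0) v t"

inductive_cases eval_elims:
  "eval P env (EVar i) v t"
  "eval P env EAtom v t"
  "eval P env (EPair e1 e2) v t"
  "eval P env (ELeft e) v t"
  "eval P env (ERight e) v t"
  "eval P env (EIf c e1 e2) v t"
  "eval P env (ELet e1 e2) v t"
  "eval P env (ECall f es) v t"
  "evals P env [] vs t"
  "evals P env (e # es) vs t"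

lemma eval_deterministic:
  "eval P env e v t \<Longrightarrow> eval P env e v' t' \<Longrightarrow> v' = v \<and> t' = t"
  "evals P env es vs s \<Longrightarrow> evals P env es vs' s' \<Longrightarrow> vs' = vs \<and> s' = s"
proof (induction arbitrary: v' t' and vs' s' rule: eval_evals.inducts)
  case (eval_Var i env) then show ?case by (auto elim: eval_elims(1))
next
  case (eval_Atom env) then show ?case by (auto elim: eval_elims(2))
next
  case (eval_Pair env e1 v1 t1 e2 v2 t2)
  from eval_Pair.prems show ?case by (rule eval_elims(3)) (metis eval_Pair.IH Suc_eq_plus1)
next
  case (eval_Left env e v t)
  from eval_Left.prems show ?case by (rule eval_elims(4)) (metis eval_Left.IH Suc_eq_plus1)
next
  case (eval_Right env e v t)
  from eval_Right.prems show ?case by (rule eval_elims(5)) (metis eval_Right.IH Suc_eq_plus1)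
next
  case (eval_If_Pair env b x y t1 e1 v t2 e2)
  from eval_If_Pair.prems show ?case
    by (rule eval_elims(6)) (metis eval_If_Pair.IH data.distinct(1) Suc_eq_plus1)+
next
  case (eval_If_Atom env b t1 e2 v t2 e1)
  from eval_If_Atom.prems show ?case
    by (rule eval_elims(6)) (metis eval_If_Atom.IH data.distinct(1) Suc_eq_plus1)+
next
  case (eval_Let env e1 v1 t1 e2 v2 t2)
  from eval_Let.prems show ?case by (rule eval_elims(7)) (metis eval_Let.IH Suc_eq_plus1)
next
  case (eval_Call env es vs t1 f v t2)
  from eval_Call.prems show ?case by (rule eval_elims(8)) (metis eval_Call.IH Suc_eq_plus1)
next
  case (evals_Nil env) then show ?case by (auto elim: eval_elims(9))
next
  case (evals_Cons env e v t1 es vs t2)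
  from evals_Cons.prems show ?case by (rule eval_elims(10)) (metis evals_Cons.IH)
qed

lemma runs_deterministic:
  "runs P inputs v t \<Longrightarrow> runs P inputs v' t' \<Longrightarrow> v' = v \<and> t' = t"
  by (auto simp: runs_def dest: eval_deterministic(1))

section \<open>Encoding of inputs and outputs\<close>

fun enc_bool :: "bool \<Rightarrow> data" where
  "enc_bool False = Atom"
| "enc_bool True = Cell Atom Atom"

fun enc_list :: "('a \<Rightarrow> data) \<Rightarrow> 'a list \<Rightarrow> data" where
  "enc_list enc [] = Atom"
| "enc_list enc (x # xs) = Cell (enc x) (enc_list enc xs)"

fun enc_option :: "('a \<Rightarrow> data) \<Rightarrow> 'a option \<Rightarrow> data" where
  "enc_option enc None = Atom"
| "enc_option enc (Some x) = Cell Atom (enc x)"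

text \<open>Binary digits, least significant first, without leading zeros.\<close>

fun binary :: "nat \<Rightarrow> bool list" where
  "binary m = (if m = 0 then [] else odd m # binary (m div 2))"

declare binary.simps [simp del]

definition enc_nat :: "nat \<Rightarrow> data" where
  "enc_nat m = enc_list enc_bool (binary m)"

text \<open>A set of arcs on the vertices \<open>0, \<dots>, n - 1\<close> is given by its adjacency matrix.\<close>

definition enc_arcs :: "nat \<Rightarrow> (nat \<times> nat) set \<Rightarrow> data" where
  "enc_arcs n A = enc_list (enc_list enc_bool) (map (\<lambda>u. map (\<lambda>v. (u, v) \<in> A) [0..<n]) [0..<n])"

definition correct_FAST_answer :: "(nat \<times> nat) set \<Rightarrow> nat \<Rightarrow> (nat \<times> nat) set option \<Rightarrow> bool" where
  "correct_FAST_answer A k ans \<longleftrightarrow>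
     (case ans of
        Some F \<Rightarrow> feedback_arc_set A F \<and> card F \<le> k
      | None \<Rightarrow> \<not> (\<exists>F. feedback_arc_set A F \<and> card F \<le> k))"

end

theory Submission
  imports Defs
begin

text \<open>
  Build a linear order of the vertices from the front. When \<open>X\<close> is the set of vertices placed so
  far, the cost of a partial order is the number of backward arcs inside \<open>X\<close> plus the number of
  arcs entering \<open>X\<close> from outside; it never decreases, and in the end it is the size of the feedback
  arc set of backward arcs. Dynamic programming over the pairs of \<open>X\<close> and a cost of at most \<open>k\<close>
  therefore finds a solution, and its running time is governed by the number of sets \<open>X\<close> of a given
  size \<open>s\<close> that are entered by at most \<open>k\<close> arcs.

  This number is \<open>2\<^bsup>O(\<surd>k)\<^esup>\<close> in every tournament. The sum of the indegrees over \<open>X\<close> is \<open>s(s-1)/2\<close>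
  plus the number of arcs entering \<open>X\<close>, so for \<open>0 < q < 1\<close> the sets are counted by the elementary
  symmetric polynomial of degree \<open>s\<close> in the numbers \<open>q\<^bsup>d(v)\<^esup>\<close>, \<open>d(v)\<close> the indegrees. Reversing an arc
  so that the indegrees of its ends move apart increases this polynomial, so the transitive
  tournament is the worst case, where the count is at most \<open>q\<^bsup>-k\<^esup> \<Prod>\<^sub>i 1/(1 - q\<^sup>i)\<close>. Take
  \<open>q = m/(m+1)\<close> with \<open>m\<close> about \<open>\<surd>k\<close>.
\<close>

section \<open>Counting the sets entered by few arcs\<close>

definition esum :: "'a set \<Rightarrow> ('a \<Rightarrow> real) \<Rightarrow> nat \<Rightarrow> real" where
  "esum V x s = (\<Sum>X\<in>{X. X \<subseteq> V \<and> card X = s}. prod x X)"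

definition indegree :: "('a \<times> 'a) set \<Rightarrow> 'a \<Rightarrow> nat" where
  "indegree A v = card {u. (u, v) \<in> A}"

lemma esum_0:
  assumes "finite V" shows "esum V x 0 = 1"
proof -
  have "{X. X \<subseteq> V \<and> card X = 0} = {{}}"
    using assms by (auto simp: card_eq_0_iff finite_subset)
  then show ?thesis by (simp add: esum_def)
qed

lemma esum_insert:
  assumes "finite V" "v \<notin> V"
  shows "esum (insert v V) x (Suc s) = esum V x (Suc s) + x v * esum V x s"
proof -
  have split: "{X. X \<subseteq> insert v V \<and> card X = Suc s} =
    {X. X \<subseteq> V \<and> card X = Suc s} \<union> insert v ` {X. X \<subseteq> V \<and> card X = s}" (is "?L = ?A \<union> ?B")
  proof (intro equalityI subsetI)
    fix X assume X: "X \<in> ?L"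
    then have fX: "finite X" using assms(1) by (auto intro: finite_subset)
    show "X \<in> ?A \<union> ?B"
    proof (cases "v \<in> X")
      case True
      then have "X = insert v (X - {v})" "X - {v} \<subseteq> V" "card (X - {v}) = s"
        using X fX by auto
      then show ?thesis by blast
    next
      case False then show ?thesis using X by auto
    qed
  next
    fix X assume "X \<in> ?A \<union> ?B"
    then show "X \<in> ?L"
    proof
      assume "X \<in> ?B"
      then obtain Y where Y: "X = insert v Y" "Y \<subseteq> V" "card Y = s" by auto
      have "finite Y" "v \<notin> Y" using Y assms by (auto intro: finite_subset)
      then show ?thesis using Y by auto
    qed auto
  qed
  have inj: "inj_on (insert v) {X. X \<subseteq> V \<and> card X = s}"
    using assms(2) by (intro inj_onI) (metis (no_types, lifting) insert_ident mem_Collect_eq subsetD)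
  have disj: "?A \<inter> ?B = {}" using assms(2) by auto
  have fin: "finite ?A" "finite ?B" using assms(1) by auto
  have "(\<Sum>X\<in>?B. prod x X) = (\<Sum>Y\<in>{X. X \<subseteq> V \<and> card X = s}. prod x (insert v Y))"
    by (subst sum.reindex[OF inj]) simp
  also have "\<dots> = (\<Sum>Y\<in>{X. X \<subseteq> V \<and> card X = s}. x v * prod x Y)"
    by (intro sum.cong refl prod.insert) (use assms in \<open>auto intro: finite_subset\<close>)
  finally show ?thesis
    unfolding esum_def split by (simp add: sum.union_disjoint[OF fin disj] sum_distrib_left)
qed

lemma esum_empty_Suc: "esum {} x (Suc s) = 0"
proof -
  have "{X. X \<subseteq> {} \<and> card X = Suc s} = {}" by auto
  then show ?thesis by (simp add: esum_def)
qed

lemma esum_cong: "(\<And>v. v \<in> V \<Longrightarrow> x v = y v) \<Longrightarrow> esum V x s = esum V y s"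
  unfolding esum_def by (intro sum.cong refl prod.cong) auto

lemma esum_nonneg: "(\<And>v. v \<in> V \<Longrightarrow> 0 \<le> x v) \<Longrightarrow> 0 \<le> esum V x s"
  unfolding esum_def by (intro sum_nonneg prod_nonneg) auto

lemma esum_scale: "esum V (\<lambda>v. c * x v) s = c ^ s * esum V x s"
proof -
  have "esum V (\<lambda>v. c * x v) s = (\<Sum>X\<in>{X. X \<subseteq> V \<and> card X = s}. c ^ s * prod x X)"
    unfolding esum_def by (intro sum.cong refl) (auto simp: prod.distrib)
  then show ?thesis by (simp add: esum_def sum_distrib_left)
qed

text \<open>As a function of two of its variables, \<open>esum\<close> is affine in their sum and their product.\<close>

lemma esum_spread:
  assumes "finite V" "u \<in> V" "v \<in> V" "u \<noteq> v"
    and eq: "\<And>w. w \<in> V \<Longrightarrow> w \<noteq> u \<Longrightarrow> w \<noteq> v \<Longrightarrow> x w = y w"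
    and nonneg: "\<And>w. w \<in> V \<Longrightarrow> 0 \<le> x w"
    and prod: "x u * x v = y u * y v" and sum: "x u + x v \<le> y u + y v"
  shows "esum V x s \<le> esum V y s"
proof -
  define W where "W = V - {u, v}"
  have W: "finite W" "u \<notin> W" "v \<notin> insert u W" "V = insert v (insert u W)"
    using assms(1-4) by (auto simp: W_def)
  have c: "esum W x r = esum W y r" for r
    by (intro esum_cong eq) (auto simp: W_def)
  have n: "0 \<le> esum W x r" for r
    by (intro esum_nonneg nonneg) (auto simp: W_def)
  show ?thesis
  proof (cases s)
    case 0 then show ?thesis using assms(1) by (simp add: esum_0)
  next
    case (Suc r)
    show ?thesis
    proof (cases r)
      case 0
      then show ?thesis using W sum c by (simp add: Suc esum_insert esum_0)
    next
      case (Suc t)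
      \<comment> \<open>With both vertices split off, the products agree for \<open>x\<close> and
        \<open>y\<close>, so only the sums differ, and their coefficient is nonnegative.\<close>
      have e: "esum V z s = esum W z (Suc r) + (z u + z v) * esum W z r + z u * z v * esum W z t" for z
        unfolding W(4) \<open>s = Suc r\<close> Suc using W by (simp add: esum_insert algebra_simps)
      show ?thesis unfolding e using prod mult_right_mono[OF sum n[of r]] by (simp add: c)
    qed
  qed
qed

section \<open>Arc reversals and the indegree generating function\<close>

lemma tournament_flip:
  assumes T: "tournament V A" and uv: "(u, v) \<in> A"
  shows "tournament V (insert (v, u) (A - {(u, v)}))"
  using assms unfolding tournament_def irrefl_def by blast

lemma indegree_flip:
  assumes T: "tournament V A" and uv: "(u, v) \<in> A"
  defines "A' \<equiv> insert (v, u) (A - {(u, v)})"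
  shows "indegree A v = Suc (indegree A' v)" "indegree A' u = Suc (indegree A u)"
    "w \<noteq> u \<Longrightarrow> w \<noteq> v \<Longrightarrow> indegree A' w = indegree A w"
proof -
  have fin: "finite V" and AV: "A \<subseteq> V \<times> V" and ne: "u \<noteq> v"
    using T uv unfolding tournament_def irrefl_def by blast+
  then have vu: "(v, u) \<notin> A" using T uv unfolding tournament_def by blast
  have f: "finite {z. (z, w) \<in> A}" for w by (rule finite_subset[OF _ fin]) (use AV in auto)
  have "{z. (z, v) \<in> A} = insert u {z. (z, v) \<in> A'}" "u \<notin> {z. (z, v) \<in> A'}"
    "finite {z. (z, v) \<in> A'}"
    using uv ne finite_subset[OF _ f[of v], of "{z. (z, v) \<in> A'}"] by (auto simp: A'_def)
  then show "indegree A v = Suc (indegree A' v)" by (simp add: indegree_def)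
  have "{z. (z, u) \<in> A'} = insert v {z. (z, u) \<in> A}" using ne by (auto simp: A'_def)
  then show "indegree A' u = Suc (indegree A u)" using f[of u] vu by (simp add: indegree_def)
  show "indegree A' w = indegree A w" if "w \<noteq> u" "w \<noteq> v"
    using that by (auto simp: A'_def indegree_def)
qed

text \<open>The right side minus the left is \<open>(1 - q) * (q ^ a - q ^ b)\<close>. If an arc has
  a head of indegree \<open>a + 1\<close> and a tail of indegree \<open>b\<close>, the right side is
  what reversing it produces.\<close>

lemma power_spread:
  fixes q :: real
  assumes "0 < q" "q < 1" "Suc a \<le> b"
  shows "q ^ b + q ^ Suc a \<le> q ^ Suc b + q ^ a"
proof -
  have "q ^ b \<le> q ^ a" using assms by (intro power_decreasing) auto
  then have "(1 - q) * q ^ b \<le> (1 - q) * q ^ a" using assms by (intro mult_left_mono) auto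
  then show ?thesis by (simp add: algebra_simps)
qed

lemma source_of_indegree_0:
  assumes "tournament V A" "v \<in> V" "indegree A v = 0"
  shows "w \<in> V \<Longrightarrow> w \<noteq> v \<Longrightarrow> (v, w) \<in> A \<and> (w, v) \<notin> A"
proof -
  have "finite {u. (u, v) \<in> A}"
    using assms(1) finite_subset[of "{u. (u, v) \<in> A}" V] unfolding tournament_def by blast
  then have "{u. (u, v) \<in> A} = {}" using assms(3) by (simp add: indegree_def)
  then show "w \<in> V \<Longrightarrow> w \<noteq> v \<Longrightarrow> (v, w) \<in> A \<and> (w, v) \<notin> A"
    using assms(1,2) unfolding tournament_def by blast
qed

lemma tournament_restrict:
  "tournament V A \<Longrightarrow> U \<subseteq> V \<Longrightarrow> tournament U (A \<inter> U \<times> U)"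
  unfolding tournament_def irrefl_def using finite_subset[of U V] by blast

text \<open>The limit of the polynomial for transitive tournaments (indegrees \<open>0, 1, \<dots>, n - 1\<close>) as \<open>n\<close>
  tends to infinity.\<close>

definition qbound :: "real \<Rightarrow> nat \<Rightarrow> real" where
  "qbound q s = q ^ (s choose 2) * (\<Prod>i=1..s. 1 / (1 - q ^ i))"

lemma qbound_0: "qbound q 0 = 1"
  by (simp add: qbound_def numeral_2_eq_2)

text \<open>In the sequence \<open>1, q, q ^ 2, ...\<close>, splitting off the variable 1 leaves the
  same sequence scaled by \<open>q\<close>, whence the powers of \<open>q\<close>. A source of a
  tournament is split off in the same way.\<close>

lemma qbound_Suc:
  assumes "0 < q" "q < 1"
  shows "qbound q (Suc s) = q ^ Suc s * qbound q (Suc s) + q ^ s * qbound q s"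
proof -
  have "q ^ Suc s < 1" using assms by (intro power_Suc_less_one) auto
  moreover have "Suc s choose 2 = (s choose 2) + s" by (simp add: numeral_2_eq_2)
  then have "qbound q (Suc s) = q ^ s * qbound q s / (1 - q ^ Suc s)"
    by (simp add: qbound_def power_add field_simps)
  ultimately show ?thesis by (simp add: field_simps)
qed

text \<open>Reversing an arc into a vertex of minimum indegree spreads the indegrees, so the
  indegree generating function grows until that vertex is a source.\<close>

lemma esum_indegree_le:
  assumes q: "0 < q" "q < 1"
  shows "tournament V A \<Longrightarrow> esum V (\<lambda>v. q ^ indegree A v) s \<le> qbound q s"
proof (induction "card V" arbitrary: V A s)
  case 0
  then have "V = {}" by (auto simp: tournament_def)
  then show ?case
  proof (cases s)
    case (Suc t)
    have "0 \<le> qbound q (Suc t)"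
      using q unfolding qbound_def
      by (intro mult_nonneg_nonneg prod_nonneg) (auto simp: power_le_one)
    then show ?thesis using Suc \<open>V = {}\<close> by (simp add: esum_empty_Suc)
  qed (simp add: esum_0 qbound_0)
next
  case (Suc n)
  have fin: "finite V" using Suc.prems by (simp add: tournament_def)
  \<comment> \<open>\<open>v\<close> stays fixed while arcs into it are reversed. The inner
    induction is on its indegree; the outer one, on the number of vertices, is used once
    \<open>v\<close> is a source.\<close>
  have main: "esum V (\<lambda>v. q ^ indegree B v) s \<le> qbound q s"
    if "tournament V B" "v \<in> V" "\<forall>w\<in>V. indegree B v \<le> indegree B w" for v B
    using that
  proof (induction "indegree B v" arbitrary: B)
    case 0
    note T = "0.prems"(1)
    have src: "(v, w) \<in> B \<and> (w, v) \<notin> B" if "w \<in> V" "w \<noteq> v" for w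
      using source_of_indegree_0[OF T "0.prems"(2)] 0 that by simp
    define U where "U = V - {v}"
    have U: "finite U" "v \<notin> U" "V = insert v U" "card U = n"
      using fin "0.prems"(2) Suc(2) by (auto simp: U_def)
    have TU: "tournament U (B \<inter> U \<times> U)"
      using T by (rule tournament_restrict) (auto simp: U_def)
    have d: "indegree B w = Suc (indegree (B \<inter> U \<times> U) w)" if "w \<in> U" for w
    proof -
      have "{u. (u, w) \<in> B} = insert v {u. (u, w) \<in> B \<inter> U \<times> U}"
        using src[of w] that T by (auto simp: U_def tournament_def)
      moreover have "finite {u. (u, w) \<in> B \<inter> U \<times> U}"
        by (rule finite_subset[OF _ U(1)]) auto
      ultimately show ?thesis using U(2) by (simp add: indegree_def)
    qed
    \<comment> \<open>Removing the source lowers every other indegree by one, so each of the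
      \<open>r\<close> factors of a monomial releases one \<open>q\<close>.\<close>
    have e: "esum U (\<lambda>v. q ^ indegree B v) r \<le> q ^ r * qbound q r" for r
    proof -
      have "esum U (\<lambda>v. q ^ indegree B v) r = q ^ r * esum U (\<lambda>v. q ^ indegree (B \<inter> U \<times> U) v) r"
        unfolding esum_scale[symmetric] by (intro esum_cong) (simp add: d)
      also have "\<dots> \<le> q ^ r * qbound q r"
        using Suc(1)[OF U(4)[symmetric] TU, of r] q by (intro mult_left_mono) auto
      finally show ?thesis .
    qed
    show ?case
    proof (cases s)
      case 0 then show ?thesis using fin by (simp add: esum_0 qbound_0)
    next
      case (Suc r)
      have "esum V (\<lambda>v. q ^ indegree B v) s =
          esum U (\<lambda>v. q ^ indegree B v) (Suc r) + esum U (\<lambda>v. q ^ indegree B v) r"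
        using U \<open>0 = indegree B v\<close> by (simp add: Suc esum_insert)
      also have "\<dots> \<le> q ^ Suc r * qbound q (Suc r) + q ^ r * qbound q r"
        by (intro add_mono e)
      also have "\<dots> = qbound q s" using qbound_Suc[OF q, of r] by (simp add: Suc)
      finally show ?thesis .
    qed
  next
    case (Suc j)
    note T = Suc.prems(1)
    have "{u. (u, v) \<in> B} \<noteq> {}" using Suc(2) unfolding indegree_def by (metis card.empty nat.distinct(1))
    then obtain u where uv: "(u, v) \<in> B" by auto
    then have V: "u \<in> V" "v \<in> V" "u \<noteq> v"
      using T by (auto simp: tournament_def irrefl_def)
    define B' where "B' = insert (v, u) (B - {(u, v)})"
    note d = indegree_flip[OF T uv, folded B'_def]
    have "esum V (\<lambda>v. q ^ indegree B v) s \<le> esum V (\<lambda>v. q ^ indegree B' v) s"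
    proof (rule esum_spread[OF fin V])
      show "q ^ indegree B u * q ^ indegree B v = q ^ indegree B' u * q ^ indegree B' v"
        by (simp add: d(1,2))
      \<comment> \<open>By minimality the tail \<open>u\<close> has at least the indegree of
        \<open>v\<close>, so the reversal drives the two indegrees apart.\<close>
      have "Suc (indegree B' v) \<le> indegree B u" using Suc.prems(3) V d(1) by auto
      from power_spread[OF q this]
      show "q ^ indegree B u + q ^ indegree B v \<le> q ^ indegree B' u + q ^ indegree B' v"
        by (simp add: d(1,2))
    qed (use q d(3) in auto)
    also have "\<dots> \<le> qbound q s"
    proof (rule Suc(1))
      show "j = indegree B' v" using Suc(2) d(1) by simp
      show "tournament V B'" unfolding B'_def by (rule tournament_flip[OF T uv])
      show "v \<in> V" by fact
      show "\<forall>w\<in>V. indegree B' v \<le> indegree B' w"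
      proof
        fix w assume "w \<in> V"
        then have "indegree B v \<le> indegree B w" using Suc.prems(3) by auto
        then show "indegree B' v \<le> indegree B' w"
          using d(1,2) d(3)[of w] Suc.prems(3) V by (cases "w = u"; cases "w = v") force+
      qed
    qed
    finally show ?case .
  qed
  have "V \<noteq> {}" using Suc(2) by auto
  then obtain v where "v \<in> V" "\<forall>w\<in>V. indegree A v \<le> indegree A w"
    using fin by (metis (no_types, lifting) arg_min_least arg_min_if_finite(1))
  then show ?case using main Suc.prems by blast
qed

section \<open>From sums of indegrees to the number of small cuts\<close>

lemma card_tournament: "tournament V A \<Longrightarrow> card A = card V choose 2"
proof (induction "card V" arbitrary: V A)
  case 0
  then have "V = {}" by (auto simp: tournament_def)
  then show ?case using 0 by (auto simp: tournament_def)
next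
  case (Suc n)
  then obtain v where v: "v \<in> V" by fastforce
  define U where "U = V - {v}"
  have fin: "finite V" and AV: "A \<subseteq> V \<times> V" and irr: "\<And>u. (u, u) \<notin> A"
    and alt: "\<And>u w. u \<in> V \<Longrightarrow> w \<in> V \<Longrightarrow> u \<noteq> w \<Longrightarrow> (u, w) \<in> A \<longleftrightarrow> (w, u) \<notin> A"
    using Suc.prems unfolding tournament_def irrefl_def by blast+
  have U: "finite U" "v \<notin> U" "V = insert v U" "card U = n"
    using fin v Suc(2) by (auto simp: U_def)
  have TU: "tournament U (A \<inter> U \<times> U)"
    using Suc.prems by (rule tournament_restrict) (auto simp: U_def)
  define g where "g w = (if (v, w) \<in> A then (v, w) else (w, v))" for w
  have A: "A = (A \<inter> U \<times> U) \<union> g ` U"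
  proof (intro equalityI subsetI)
    fix e assume e: "e \<in> A"
    obtain a b where ab: "e = (a, b)" by (cases e)
    have V: "a \<in> V" "b \<in> V" "a \<noteq> b" using e ab AV irr by auto
    consider "a = v" | "b = v" | "a \<noteq> v" "b \<noteq> v" by blast
    then show "e \<in> (A \<inter> U \<times> U) \<union> g ` U"
    proof cases
      case 1
      then have "e = g b" "b \<in> U" using e ab V by (auto simp: g_def U_def)
      then show ?thesis by blast
    next
      case 2
      then have "(v, a) \<notin> A" using alt[OF V] e ab by simp
      then have "e = g a" "a \<in> U" using 2 ab V by (auto simp: g_def U_def)
      then show ?thesis by blast
    next
      case 3 then show ?thesis using e ab V by (auto simp: U_def)
    qed
  next
    fix e assume "e \<in> (A \<inter> U \<times> U) \<union> g ` U"
    then show "e \<in> A"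
    proof
      assume "e \<in> g ` U"
      then obtain w where "w \<in> V" "w \<noteq> v" "e = g w" by (auto simp: U_def)
      then show ?thesis using alt[of v w] v by (auto simp: g_def)
    qed auto
  qed
  have "card (g ` U) = n"
    using U by (subst card_image) (auto simp: inj_on_def g_def split: if_splits)
  moreover have "(A \<inter> U \<times> U) \<inter> g ` U = {}" using U(2) by (auto simp: g_def)
  moreover have "finite (A \<inter> U \<times> U)" using U(1) by auto
  ultimately have "card ((A \<inter> U \<times> U) \<union> g ` U) = card (A \<inter> U \<times> U) + n"
    using U(1) by (subst card_Un_disjoint) auto
  then have "card A = card (A \<inter> U \<times> U) + n" using arg_cong[OF A, of card] by linarith
  also have "card (A \<inter> U \<times> U) = n choose 2" using Suc(1)[OF _ TU] U(4) by simp
  finally show ?case unfolding Suc(2)[symmetric] by (simp add: numeral_2_eq_2)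
qed

text \<open>The sum counts the arcs with head in \<open>X\<close>: those with both ends in
  \<open>X\<close> form a tournament, the others enter \<open>X\<close> from outside.\<close>

lemma sum_indegree:
  assumes T: "tournament V A" and X: "X \<subseteq> V"
  shows "(\<Sum>v\<in>X. indegree A v) = (card X choose 2) + card (A \<inter> (- X) \<times> X)"
proof -
  have fin: "finite V" "A \<subseteq> V \<times> V" using T by (auto simp: tournament_def)
  have finX: "finite X" "finite A"
    using finite_subset[OF X fin(1)] finite_subset[OF fin(2)] fin(1) by auto
  have f: "finite {u. (u, v) \<in> A}" for v by (rule finite_subset[OF _ fin(1)]) (use fin(2) in auto)
  have "(\<Sum>v\<in>X. indegree A v) = card (SIGMA v:X. {u. (u, v) \<in> A})"
    using finX f by (simp add: indegree_def)
  also have "\<dots> = card (prod.swap ` (SIGMA v:X. {u. (u, v) \<in> A}))"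
    by (simp add: card_image)
  also have "prod.swap ` (SIGMA v:X. {u. (u, v) \<in> A}) = (A \<inter> X \<times> X) \<union> (A \<inter> (- X) \<times> X)"
    by (auto simp: image_iff)
  also have "card \<dots> = card (A \<inter> X \<times> X) + card (A \<inter> (- X) \<times> X)"
    using finX(2) by (intro card_Un_disjoint) auto
  also have "card (A \<inter> X \<times> X) = card X choose 2"
    by (rule card_tournament[OF tournament_restrict[OF T X]])
  finally show ?thesis .
qed

definition small_cuts :: "'a set \<Rightarrow> ('a \<times> 'a) set \<Rightarrow> nat \<Rightarrow> nat \<Rightarrow> 'a set set" where
  "small_cuts V A s k = {X. X \<subseteq> V \<and> card X = s \<and> card (A \<inter> (- X) \<times> X) \<le> k}"

text \<open>Rankin's trick: every counted set has weight at least
  \<open>q ^ ((s choose 2) + k)\<close> in the indegree polynomial, and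
  \<open>q ^ (s choose 2)\<close> cancels against the same factor of \<open>qbound\<close>.\<close>

lemma card_small_cuts_mult_le:
  assumes T: "tournament V A" and q: "0 < q" "q < 1"
  shows "real (card (small_cuts V A s k)) * q ^ k \<le> (\<Prod>i=1..s. 1 / (1 - q ^ i))"
proof -
  have fin: "finite V" using T by (simp add: tournament_def)
  have "q ^ (s choose 2) * (real (card (small_cuts V A s k)) * q ^ k)
      = (\<Sum>X\<in>small_cuts V A s k. q ^ ((s choose 2) + k))"
    by (simp add: power_add)
  also have "\<dots> \<le> (\<Sum>X\<in>small_cuts V A s k. \<Prod>v\<in>X. q ^ indegree A v)"
    using q sum_indegree[OF T]
    by (intro sum_mono) (auto simp: small_cuts_def power_sum[symmetric] intro!: power_decreasing)
  also have "\<dots> \<le> esum V (\<lambda>v. q ^ indegree A v) s"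
    unfolding esum_def using fin q
    by (intro sum_mono2) (auto simp: small_cuts_def intro: prod_nonneg)
  also have "\<dots> \<le> qbound q s" by (rule esum_indegree_le[OF q T])
  finally show ?thesis using q by (simp add: qbound_def)
qed

section \<open>Estimate of the product at \<open>q = m / (m + 1)\<close>\<close>

text \<open>The factors with \<open>i \<le> m\<close> contribute at most the binomial coefficient \<open>2m\<close> over \<open>m\<close>;
  the remaining ones are dominated by a geometric series.\<close>

lemma partition_product_le:
  assumes m: "0 < m"
  defines "q \<equiv> real m / (real m + 1)"
  shows "(\<Prod>i=1..s. 1 / (1 - q ^ i)) \<le> 4 ^ m * exp (real m)"
proof -
  have q: "0 < q" "q < 1" using m by (auto simp: q_def field_simps)
  have iq: "1 / q = 1 + 1 / real m" using m by (simp add: q_def field_simps)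
  \<comment> \<open>Bernoulli's inequality for \<open>(1 + 1 / m) ^ i\<close>, the inverse of
    \<open>q ^ i\<close>. At \<open>i = m\<close> it gives \<open>q ^ m \<le> 1 / 2\<close>, which
    is why the product is split at \<open>m\<close>.\<close>
  have B: "q ^ i \<le> real m / (real m + real i)" for i
  proof -
    have "1 + real i * (1 / real m) \<le> (1 + 1 / real m) ^ i"
      by (rule Bernoulli_inequality, rule order_trans[of _ 0]) auto
    also have "\<dots> = 1 / q ^ i" unfolding iq[symmetric] by (simp add: power_one_over)
    finally have "q ^ i * (1 + real i / real m) \<le> 1" using q by (simp add: field_simps)
    then show ?thesis using m by (simp add: field_simps)
  qed
  have lt: "q ^ i < 1" if "1 \<le> i" for i using q that by (simp add: power_less_one_iff)
  have small: "1 / (1 - q ^ i) \<le> (real m + real i) / real i" if "1 \<le> i" for i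
  proof -
    have "real i / (real m + real i) \<le> 1 - q ^ i" using B[of i] that m by (simp add: field_simps)
    moreover have "0 < real i / (real m + real i)" using that m by simp
    ultimately have "1 / (1 - q ^ i) \<le> 1 / (real i / (real m + real i))"
      by (intro divide_left_mono mult_pos_pos) linarith+
    then show ?thesis by simp
  qed
  have large: "1 / (1 - q ^ i) \<le> exp (2 * q ^ i)" if "m \<le> i" for i
  proof -
    have "q ^ i \<le> q ^ m" using q that by (intro power_decreasing) auto
    also have "\<dots> \<le> 1 / 2" using B[of m] m by simp
    finally have half: "q ^ i \<le> 1 / 2" .
    have p: "0 < q ^ i" using q by simp
    have "1 / (1 - q ^ i) \<le> 1 + 2 * q ^ i"
    proof -
      have "q ^ i * (2 * q ^ i) \<le> q ^ i * 1" using half p by (intro mult_left_mono) auto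
      then show ?thesis using half by (simp add: field_simps)
    qed
    also have "\<dots> \<le> exp (2 * q ^ i)" by (rule exp_ge_add_one_self)
    finally show ?thesis .
  qed
  have first: "(\<Prod>i=1..m. (real m + real i) / real i) \<le> 4 ^ m"
  proof -
    \<comment> \<open>The product telescopes: factor \<open>i\<close> is the ratio of
      \<open>(m + i) choose i\<close> to \<open>(m + i - 1) choose (i - 1)\<close>.\<close>
    have "(\<Prod>i=1..j. (real m + real i) / real i) = real ((m + j) choose j)" for j
    proof (induction j)
      case (Suc j)
      have "real (Suc j) * real ((m + Suc j) choose Suc j) = real (m + Suc j) * real ((m + j) choose j)"
        using Suc_times_binomial_eq[of "m + j" j] by (metis add_Suc_right of_nat_mult mult.commute)
      then show ?case using Suc by (simp add: field_simps)
    qed simp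
    then have "(\<Prod>i=1..m. (real m + real i) / real i) = real ((m + m) choose m)" .
    also have "\<dots> \<le> real (2 ^ (m + m))" by (intro of_nat_mono binomial_le_pow2)
    also have "\<dots> = 4 ^ m" by (simp add: power_add power_mult_distrib[symmetric])
    finally show ?thesis .
  qed
  have tail: "(\<Prod>i=Suc m..s. exp (2 * q ^ i)) \<le> exp (real m)"
  proof -
    have "(\<Sum>i=Suc m..s. q ^ i) \<le> q ^ Suc m / (1 - q)"
    proof (cases "Suc m \<le> s")
      case True
      then show ?thesis using q by (auto simp: sum_gp intro!: divide_right_mono)
    qed (use q in auto)
    also have "\<dots> = q / (1 - q) * q ^ m" by simp
    also have "\<dots> = real m * q ^ m"
    proof -
      have "q / (1 - q) = real m" by (simp add: q_def field_simps)
      then show ?thesis by simp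
    qed
    also have "\<dots> \<le> real m * (1 / 2)" using B[of m] m by (intro mult_left_mono) auto
    finally have "2 * (\<Sum>i=Suc m..s. q ^ i) \<le> real m" by simp
    then show ?thesis by (simp add: exp_sum[symmetric] sum_distrib_left[symmetric])
  qed
  have pos: "0 \<le> 1 / (1 - q ^ i)" if "1 \<le> i" for i using lt[OF that] by simp
  have ge1: "1 \<le> 1 / (1 - q ^ i)" if "1 \<le> i" for i using lt[OF that] q by simp
  \<comment> \<open>All factors are at least 1, so extending the range to \<open>max m s\<close>
    permits the split at \<open>m\<close> even when \<open>s < m\<close>.\<close>
  have "(\<Prod>i=1..s. 1 / (1 - q ^ i)) \<le> (\<Prod>i=1..max m s. 1 / (1 - q ^ i))"
    using ge1 pos by (intro prod_mono2) auto
  also have "\<dots> = (\<Prod>i=1..m. 1 / (1 - q ^ i)) * (\<Prod>i=Suc m..max m s. 1 / (1 - q ^ i))"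
    by (subst prod.union_disjoint[symmetric]) (auto intro!: prod.cong)
  also have "\<dots> \<le> (\<Prod>i=1..m. (real m + real i) / real i) * (\<Prod>i=Suc m..max m s. exp (2 * q ^ i))"
    using small large pos by (intro mult_mono prod_mono prod_nonneg) auto
  also have "(\<Prod>i=Suc m..max m s. exp (2 * q ^ i)) = (\<Prod>i=Suc m..s. exp (2 * q ^ i))"
    by (intro prod.cong) auto
  also have "(\<Prod>i=1..m. (real m + real i) / real i) * \<dots> \<le> 4 ^ m * exp (real m)"
    using first tail by (intro mult_mono) (auto intro: prod_nonneg)
  finally show ?thesis .
qed

text \<open>With \<open>q = m / (m + 1)\<close>, the inverse of \<open>q ^ k\<close> is at most
  \<open>exp (k / m) \<le> exp m\<close>. The total \<open>4 ^ m * exp m * exp m\<close> is at most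
  \<open>4 ^ (3 * m)\<close>, as \<open>exp 1 \<le> 4\<close>.\<close>

lemma card_small_cuts_le:
  assumes T: "tournament V A" and m: "0 < m" and k: "k \<le> m ^ 2"
  shows "card (small_cuts V A s k) \<le> 2 ^ (6 * m)"
proof -
  define q where "q = real m / (real m + 1)"
  have q: "0 < q" "q < 1" using m by (auto simp: q_def field_simps)
  have iq: "1 / q = 1 + 1 / real m" using m by (simp add: q_def field_simps)
  have "(1 / q) ^ k \<le> exp (1 / real m) ^ k"
    unfolding iq using m by (intro power_mono exp_ge_add_one_self) auto
  also have "\<dots> = exp (real k / real m)" by (simp add: exp_of_nat_mult[symmetric])
  also have "\<dots> \<le> exp (real m)"
  proof -
    have "real k \<le> real m * real m" using k by (metis of_nat_mult of_nat_mono power2_eq_square)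
    then show ?thesis using m by (simp add: field_simps)
  qed
  finally have qk: "(1 / q) ^ k \<le> exp (real m)" .
  have "real (card (small_cuts V A s k)) * q ^ k \<le> 4 ^ m * exp (real m)"
    using card_small_cuts_mult_le[OF T q, of s k] partition_product_le[OF m, of s]
    unfolding q_def by linarith
  then have "real (card (small_cuts V A s k)) \<le> 4 ^ m * exp (real m) * (1 / q) ^ k"
    using q by (simp add: field_simps power_divide)
  also have "\<dots> \<le> 4 ^ m * exp (real m) * exp (real m)"
    using qk by (intro mult_left_mono) auto
  also have "\<dots> \<le> 4 ^ m * 4 ^ m * 4 ^ m"
  proof -
    have "exp (real m) = exp 1 ^ m" by (simp add: exp_of_nat_mult[symmetric])
    also have "\<dots> \<le> 4 ^ m" using exp_le by (intro power_mono) auto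
    finally show ?thesis by (intro mult_mono) auto
  qed
  also have "\<dots> = real (2 ^ (6 * m))" by (simp add: power_mult power_mult_distrib[symmetric])
  finally show ?thesis by (simp only: of_nat_le_iff)
qed

section \<open>Symbolic evaluation\<close>

text \<open>A weakest precondition for total correctness: termination is included, and the
  postcondition also sees the number of steps.\<close>

definition wp :: "program \<Rightarrow> data list \<Rightarrow> exp \<Rightarrow> (data \<Rightarrow> nat \<Rightarrow> bool) \<Rightarrow> bool" where
  "wp P env e Q \<longleftrightarrow> (\<exists>v t. eval P env e v t \<and> Q v t)"

definition wps :: "program \<Rightarrow> data list \<Rightarrow> exp list \<Rightarrow> (data list \<Rightarrow> nat \<Rightarrow> bool) \<Rightarrow> bool" where
  "wps P env es Q \<longleftrightarrow> (\<exists>vs t. evals P env es vs t \<and> Q vs t)"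

text \<open>Determinism gives an equivalence for every \<open>Q\<close>, so a known evaluation can
  serve as a rewrite rule.\<close>

lemma wp_eval: "eval P env e v t \<Longrightarrow> wp P env e Q \<longleftrightarrow> Q v t"
  unfolding wp_def using eval_deterministic(1) by blast

text \<open>Read from left to right, these equations execute a function body. A call leaves
  \<open>wp P vs (P ! f)\<close>, to be resolved by a rule for the callee.\<close>

lemma wp_simps:
  "i < length env \<Longrightarrow> wp P env (EVar i) Q \<longleftrightarrow> Q (env ! i) 1"
  "wp P env EAtom Q \<longleftrightarrow> Q Atom 1"
  "wp P env (EPair e1 e2) Q \<longleftrightarrow> wp P env e1 (\<lambda>x s. wp P env e2 (\<lambda>y t. Q (Cell x y) (s + t + 1)))"
  "wp P env (ELeft e) Q \<longleftrightarrow> wp P env e (\<lambda>x t. Q (left x) (t + 1))"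
  "wp P env (ERight e) Q \<longleftrightarrow> wp P env e (\<lambda>x t. Q (right x) (t + 1))"
  "wp P env (EIf c e1 e2) Q \<longleftrightarrow>
     wp P env c (\<lambda>x s. if x = Atom then wp P env e2 (\<lambda>y t. Q y (s + t + 1))
                        else wp P env e1 (\<lambda>y t. Q y (s + t + 1)))"
  "wp P env (ELet e1 e2) Q \<longleftrightarrow> wp P env e1 (\<lambda>x s. wp P (x # env) e2 (\<lambda>y t. Q y (s + t + 1)))"
  "wp P env (ECall f es) Q \<longleftrightarrow>
     wps P env es (\<lambda>vs s. f < length P \<and> wp P vs (P ! f) (\<lambda>y t. Q y (s + t + 1)))"
  "wps P env [] R \<longleftrightarrow> R [] 0"
  "wps P env (e # es) R \<longleftrightarrow> wp P env e (\<lambda>x s. wps P env es (\<lambda>xs t. R (x # xs) (s + t)))"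
proof goal_cases
  case 6
  show ?case
  proof
    assume "wp P env (EIf c e1 e2) Q"
    then show "wp P env c (\<lambda>x s. if x = Atom then wp P env e2 (\<lambda>y t. Q y (s + t + 1))
                        else wp P env e1 (\<lambda>y t. Q y (s + t + 1)))"
      unfolding wp_def by (fastforce elim: eval_elims(6))
  next
    assume "wp P env c (\<lambda>x s. if x = Atom then wp P env e2 (\<lambda>y t. Q y (s + t + 1))
                        else wp P env e1 (\<lambda>y t. Q y (s + t + 1)))"
    then obtain x s where x: "eval P env c x s"
      "if x = Atom then wp P env e2 (\<lambda>y t. Q y (s + t + 1)) else wp P env e1 (\<lambda>y t. Q y (s + t + 1))"
      unfolding wp_def by blast
    then show "wp P env (EIf c e1 e2) Q"
      unfolding wp_def by (cases x) (simp_all del: One_nat_def, (blast intro: eval_evals.intros)+)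
  qed
qed (unfold wp_def wps_def;
    fastforce intro: eval_evals.intros[simplified] elim: eval_elims)+

fun un :: "nat \<Rightarrow> data" where
  "un 0 = Atom"
| "un (Suc n) = Cell Atom (un n)"

lemma right_un [simp]: "right (un b) = un (b - 1)" by (cases b) auto
lemma un_eq_Atom [simp]: "un b = Atom \<longleftrightarrow> b = 0" by (cases b) auto
lemma size_un [simp]: "size (un b) = b" by (induction b) auto
lemma un_eq_un [simp]: "un a = un b \<longleftrightarrow> a = b"
  by (metis size_un)

lemma enc_bool_eq_Atom [simp]: "enc_bool x = Atom \<longleftrightarrow> \<not> x" by (cases x) auto
lemma enc_bool_inject [simp]: "enc_bool x = enc_bool y \<longleftrightarrow> x = y" by (cases x; cases y) auto
lemma enc_list_eq_Atom [simp]: "enc_list f xs = Atom \<longleftrightarrow> xs = []" by (cases xs) auto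
lemma enc_list_inject:
  "(\<And>x y. f x = f y \<longleftrightarrow> x = y) \<Longrightarrow> enc_list f xs = enc_list f ys \<longleftrightarrow> xs = ys"
proof (induction xs arbitrary: ys)
  case Nil then show ?case by (cases ys) auto
next
  case (Cons x xs) then show ?case by (cases ys) auto
qed

lemma size_enc_bools: "size (enc_list enc_bool xs) \<le> 2 * length xs"
proof (induction xs)
  case (Cons x xs) then show ?case by (cases x) auto
qed simp

section \<open>The dynamic program on lists\<close>

text \<open>A state lists, for every vertex, whether it has been placed and its current row of the
  adjacency matrix. The key of a state is its set of placed vertices with the remaining budget.\<close>

type_synonym state = "(bool \<times> bool list) list"
type_synonym layer = "((bool list \<times> nat) \<times> state) list"

definition enc_vertex :: "bool \<times> bool list \<Rightarrow> data" where
  "enc_vertex p = Cell (enc_bool (fst p)) (enc_list enc_bool (snd p))"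

abbreviation enc_state :: "state \<Rightarrow> data" where
  "enc_state \<equiv> enc_list enc_vertex"

definition enc_key :: "bool list \<times> nat \<Rightarrow> data" where
  "enc_key c = Cell (enc_list enc_bool (fst c)) (un (snd c))"

definition enc_entry :: "(bool list \<times> nat) \<times> state \<Rightarrow> data" where
  "enc_entry e = Cell (enc_key (fst e)) (enc_state (snd e))"

text \<open>Makes the tree comparison \<open>f_eq\<close> a test for equality of keys.\<close>

lemma enc_key_inject [simp]: "enc_key c = enc_key d \<longleftrightarrow> c = d"
  by (cases c; cases d) (auto simp: enc_key_def enc_list_inject)

definition overlap :: "bool list \<Rightarrow> state \<Rightarrow> nat" where
  "overlap row s = length (filter (\<lambda>(r, p). r \<and> fst p) (zip row s))"

lemma overlap_simps [simp]:
  "overlap [] s = 0" "overlap row [] = 0"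
  "overlap (r # row) (p # s) = (if r \<and> fst p then Suc (overlap row s) else overlap row s)"
  by (auto simp: overlap_def)

text \<open>Used with \<open>rest = s\<close>, where it counts the arcs in the current rows whose
  head is placed. The arguments are separate because the recursion of the program consumes one while
  the other keeps all flags.\<close>

definition cost :: "state \<Rightarrow> state \<Rightarrow> nat" where
  "cost rest s = (\<Sum>p\<leftarrow>rest. overlap (snd p) s)"

text \<open>Applied to the row of a vertex being placed, this drops its arcs to vertices not yet
  placed, which will point forward.\<close>

definition restrict :: "bool list \<Rightarrow> state \<Rightarrow> bool list" where
  "restrict row s = map2 (\<lambda>r p. r \<and> fst p) row s"

fun succs :: "state \<Rightarrow> state \<Rightarrow> state list" where
  "succs [] s = []"
| "succs (p # rest) s =
     (if fst p then [] else [(True, restrict (snd p) s) # rest]) @ map ((#) p) (succs rest s)"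

text \<open>\<open>K\<close> will be \<open>k + 1\<close>, so a remaining budget of zero means a
  cost above \<open>k\<close>, and the state is dropped. Keeping one state per key bounds the length
  of a layer by the number of keys.\<close>

fun add_states :: "nat \<Rightarrow> state list \<Rightarrow> layer \<Rightarrow> layer" where
  "add_states K [] L = L"
| "add_states K (s # ss) L = add_states K ss
     (let c = (map fst s, K - cost s s)
      in if snd c = 0 \<or> c \<in> fst ` set L then L else (c, s) # L)"

fun expand :: "nat \<Rightarrow> layer \<Rightarrow> layer \<Rightarrow> layer" where
  "expand K [] L = L"
| "expand K (e # es) L = expand K es (add_states K (succs (snd e) (snd e)) L)"

section \<open>The program\<close>

text \<open>The budget is a unary number. Decreasing it by \<open>ERight\<close> truncates at zero, so,
  started at \<open>k + 1\<close>, it ends positive iff the cost is at most \<open>k\<close>.\<close>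

definition "f_dec = (1::nat)"
definition "f_budget = (2::nat)"
definition "f_restrict = (3::nat)"
definition "f_consall = (4::nat)"
definition "f_succs = (5::nat)"
definition "f_flags = (6::nat)"
definition "f_eq = (7::nat)"
definition "f_mem = (8::nat)"
definition "f_add = (9::nat)"
definition "f_expand = (10::nat)"
definition "f_iter = (11::nat)"
definition "f_init = (12::nat)"
definition "f_rows = (13::nat)"
definition "f_dbl = (14::nat)"
definition "f_unary = (15::nat)"

text \<open>The let-bound values are the unary budget \<open>k + 1\<close>, the initial state and
  the last layer. The matrix passed to \<open>f_iter\<close> is a round counter, and the answer is
  read off the first entry of the last layer.\<close>

definition "body_main =
  ELet (EPair EAtom (ECall f_unary [EVar 1]))
  (ELet (ECall f_init [EVar 1])
  (ELet (ECall f_iter [EVar 2,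
      EPair (EPair (EPair (ECall f_flags [EVar 0]) (EVar 1)) (EVar 0)) EAtom, EVar 1])
  (EIf (EVar 0) (EPair EAtom (ECall f_rows [ERight (ELeft (EVar 0))])) EAtom)))"

definition "body_dec =
  EIf (EVar 0) (EIf (EVar 1)
    (ECall f_dec [ERight (EVar 0), ERight (EVar 1),
       EIf (ELeft (EVar 0)) (EIf (ELeft (ELeft (EVar 1))) (ERight (EVar 2)) (EVar 2)) (EVar 2)])
    (EVar 2)) (EVar 2)"

definition "body_budget =
  EIf (EVar 0)
    (ECall f_budget [ERight (EVar 0), EVar 1,
       ECall f_dec [ERight (ELeft (EVar 0)), EVar 1, EVar 2]])
    (EVar 2)"

definition "body_restrict =
  EIf (EVar 0) (EIf (EVar 1)
    (EPair (EIf (ELeft (EVar 0)) (ELeft (ELeft (EVar 1))) EAtom)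
       (ECall f_restrict [ERight (EVar 0), ERight (EVar 1)]))
    EAtom) EAtom"

definition "body_consall =
  EIf (EVar 1)
    (EPair (EPair (EVar 0) (ELeft (EVar 1))) (ECall f_consall [EVar 0, ERight (EVar 1)]))
    EAtom"

definition "body_succs =
  EIf (EVar 0)
    (ELet (ECall f_consall [ELeft (EVar 0), ECall f_succs [ERight (EVar 0), EVar 1]])
      (EIf (ELeft (ELeft (EVar 1))) (EVar 0)
        (EPair (EPair (EPair (EPair EAtom EAtom) (ECall f_restrict [ERight (ELeft (EVar 1)), EVar 2]))
            (ERight (EVar 1))) (EVar 0))))
    EAtom"

definition "body_flags =
  EIf (EVar 0) (EPair (ELeft (ELeft (EVar 0))) (ECall f_flags [ERight (EVar 0)])) EAtom"

definition "body_eq =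
  EIf (EVar 0)
    (EIf (EVar 1)
      (EIf (ECall f_eq [ELeft (EVar 0), ELeft (EVar 1)])
        (ECall f_eq [ERight (EVar 0), ERight (EVar 1)]) EAtom) EAtom)
    (EIf (EVar 1) EAtom (EPair EAtom EAtom))"

definition "body_mem =
  EIf (EVar 1)
    (EIf (ECall f_eq [EVar 0, ELeft (ELeft (EVar 1))]) (EPair EAtom EAtom)
      (ECall f_mem [EVar 0, ERight (EVar 1)]))
    EAtom"

definition "body_add =
  EIf (EVar 0)
    (ELet (ECall f_budget [ELeft (EVar 0), ELeft (EVar 0), EVar 2])
      (EIf (EVar 0)
        (ELet (EPair (ECall f_flags [ELeft (EVar 1)]) (EVar 0))
          (EIf (ECall f_mem [EVar 0, EVar 3])
            (ECall f_add [ERight (EVar 2), EVar 3, EVar 4])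
            (ECall f_add [ERight (EVar 2),
               EPair (EPair (EVar 0) (ELeft (EVar 2))) (EVar 3), EVar 4])))
        (ECall f_add [ERight (EVar 1), EVar 2, EVar 3])))
    (EVar 1)"

definition "body_expand =
  EIf (EVar 0)
    (ECall f_expand [ERight (EVar 0),
       ECall f_add [ECall f_succs [ERight (ELeft (EVar 0)), ERight (ELeft (EVar 0))], EVar 1, EVar 2],
       EVar 2])
    (EVar 1)"

definition "body_iter =
  EIf (EVar 0)
    (ECall f_iter [ERight (EVar 0), ECall f_expand [EVar 1, EAtom, EVar 2], EVar 2])
    (EVar 1)"

definition "body_init =
  EIf (EVar 0) (EPair (EPair EAtom (ELeft (EVar 0))) (ECall f_init [ERight (EVar 0)])) EAtom"

definition "body_rows =
  EIf (EVar 0) (EPair (ERight (ELeft (EVar 0))) (ECall f_rows [ERight (EVar 0)])) EAtom"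

definition "body_dbl =
  EIf (EVar 0) (EPair EAtom (EPair EAtom (ECall f_dbl [ERight (EVar 0)]))) EAtom"

definition "body_unary =
  EIf (EVar 0)
    (ELet (ECall f_dbl [ECall f_unary [ERight (EVar 0)]])
      (EIf (ELeft (EVar 1)) (EPair EAtom (EVar 0)) (EVar 0)))
    EAtom"

definition prog :: program where
  "prog = [body_main, body_dec, body_budget, body_restrict, body_consall, body_succs, body_flags,
     body_eq, body_mem, body_add, body_expand, body_iter, body_init, body_rows, body_dbl,
     body_unary]"

lemmas f_defs = f_dec_def f_budget_def f_restrict_def f_consall_def f_succs_def f_flags_def
  f_eq_def f_mem_def f_add_def f_expand_def f_iter_def f_init_def f_rows_def f_dbl_def f_unary_def

lemma prog_nth:
  "prog ! 0 = body_main" "prog ! f_dec = body_dec" "prog ! f_budget = body_budget"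
  "prog ! f_restrict = body_restrict" "prog ! f_consall = body_consall"
  "prog ! f_succs = body_succs" "prog ! f_flags = body_flags" "prog ! f_eq = body_eq"
  "prog ! f_mem = body_mem" "prog ! f_add = body_add" "prog ! f_expand = body_expand"
  "prog ! f_iter = body_iter" "prog ! f_init = body_init" "prog ! f_rows = body_rows"
  "prog ! f_dbl = body_dbl" "prog ! f_unary = body_unary"
  by (simp_all add: prog_def f_defs)

lemma f_less [simp]:
  "f_dec < length prog" "f_budget < length prog" "f_restrict < length prog"
  "f_consall < length prog" "f_succs < length prog" "f_flags < length prog"
  "f_eq < length prog" "f_mem < length prog" "f_add < length prog" "f_expand < length prog"
  "f_iter < length prog" "f_init < length prog" "f_rows < length prog" "f_dbl < length prog"
  "f_unary < length prog"
  by (simp_all add: prog_def f_defs)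

section \<open>Values and running times of the functions\<close>

definition computes :: "nat \<Rightarrow> data list \<Rightarrow> data \<Rightarrow> nat \<Rightarrow> bool" where
  "computes f vs v b \<longleftrightarrow> (\<exists>t\<le>b. eval prog vs (prog ! f) v t)"

lemma computes_wp: "computes f vs v b \<longleftrightarrow> wp prog vs (prog ! f) (\<lambda>x t. x = v \<and> t \<le> b)"
  by (auto simp: computes_def wp_def)

text \<open>Turns a time bound into an exact, though unknown, step count with a rewrite rule for the
  call. The constants in the bounds below leave slack.\<close>

lemma computesE:
  assumes "computes f vs v b"
  obtains t where "t \<le> b" "\<And>Q. wp prog vs (prog ! f) Q \<longleftrightarrow> Q v t"
  using assms by (auto simp: computes_def wp_eval)

lemma computes_dec:
  "computes f_dec [enc_list enc_bool row, enc_state s, un b] (un (b - overlap row s)) (30 * length row + 10)"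
proof (induction row arbitrary: s b)
  case Nil
  show ?case unfolding computes_wp prog_nth body_dec_def by (simp add: wp_simps)
next
  case (Cons r row)
  show ?case
  proof (cases s)
    case Nil
    then show ?thesis unfolding computes_wp prog_nth body_dec_def by (simp add: wp_simps)
  next
    case s: (Cons p s')
    obtain t where t: "t \<le> 30 * length row + 10"
      "\<And>Q. wp prog [enc_list enc_bool row, enc_state s', un (if r \<and> fst p then b - 1 else b)] (prog ! f_dec) Q
         \<longleftrightarrow> Q (un ((if r \<and> fst p then b - 1 else b) - overlap row s')) t"
      using computesE[OF Cons.IH[of s' "if r \<and> fst p then b - 1 else b"]] by blast
    show ?thesis
      unfolding computes_wp prog_nth(2) body_dec_def
      using t by (cases r; cases "fst p") (simp_all add: s wp_simps enc_vertex_def)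
  qed
qed

lemma computes_budget:
  assumes "\<forall>p\<in>set rest. length (snd p) \<le> n"
  shows "computes f_budget [enc_state rest, enc_state s, un b] (un (b - cost rest s))
    ((30 * n + 40) * length rest + 10)"
  using assms
proof (induction rest arbitrary: b)
  case Nil
  show ?case unfolding computes_wp prog_nth body_budget_def by (simp add: wp_simps cost_def)
next
  case (Cons p rest)
  obtain t where t: "t \<le> 30 * length (snd p) + 10"
      "\<And>Q. wp prog [enc_list enc_bool (snd p), enc_state s, un b] (prog ! f_dec) Q
         \<longleftrightarrow> Q (un (b - overlap (snd p) s)) t"
      using computesE[OF computes_dec] by blast
  obtain t' where t': "t' \<le> (30 * n + 40) * length rest + 10"
      "\<And>Q. wp prog [enc_state rest, enc_state s, un (b - overlap (snd p) s)] (prog ! f_budget) Q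
         \<longleftrightarrow> Q (un (b - overlap (snd p) s - cost rest s)) t'"
      using computesE[OF Cons.IH[of "b - overlap (snd p) s"]] Cons.prems by auto
  show ?case
    unfolding computes_wp prog_nth(3) body_budget_def
    using t t' Cons.prems by (simp add: wp_simps enc_vertex_def cost_def algebra_simps)
qed

lemma computes_restrict:
  "computes f_restrict [enc_list enc_bool row, enc_state s] (enc_list enc_bool (restrict row s))
    (30 * length row + 10)"
proof (induction row arbitrary: s)
  case Nil
  show ?case unfolding computes_wp prog_nth body_restrict_def by (simp add: wp_simps restrict_def)
next
  case (Cons r row)
  show ?case
  proof (cases s)
    case Nil
    then show ?thesis unfolding computes_wp prog_nth body_restrict_def
      by (simp add: wp_simps restrict_def)
  next
    case s: (Cons p s')
    obtain t where t: "t \<le> 30 * length row + 10"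
      "\<And>Q. wp prog [enc_list enc_bool row, enc_state s'] (prog ! f_restrict) Q
         \<longleftrightarrow> Q (enc_list enc_bool (restrict row s')) t"
      using computesE[OF Cons.IH[of s']] by blast
    show ?thesis
      unfolding computes_wp prog_nth(4) body_restrict_def
      using t by (cases r) (simp_all add: s wp_simps enc_vertex_def restrict_def)
  qed
qed

lemma computes_consall:
  "computes f_consall [enc_vertex p, enc_list enc_state ss] (enc_list enc_state (map ((#) p) ss))
    (30 * length ss + 10)"
proof (induction ss)
  case Nil
  show ?case unfolding computes_wp prog_nth body_consall_def by (simp add: wp_simps)
next
  case (Cons s ss)
  obtain t where t: "t \<le> 30 * length ss + 10"
      "\<And>Q. wp prog [enc_vertex p, enc_list enc_state ss] (prog ! f_consall) Q
         \<longleftrightarrow> Q (enc_list enc_state (map ((#) p) ss)) t"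
      using computesE[OF Cons.IH] by blast
  show ?case
    unfolding computes_wp prog_nth(5) body_consall_def using t by (simp add: wp_simps)
qed

lemma length_succs: "length (succs rest s) \<le> length rest"
  by (induction rest) auto

lemma computes_succs:
  assumes "\<forall>p\<in>set rest. length (snd p) \<le> n" "length rest \<le> n"
  shows "computes f_succs [enc_state rest, enc_state s] (enc_list enc_state (succs rest s))
    ((60 * n + 80) * length rest + 10)"
  using assms
proof (induction rest)
  case Nil
  show ?case unfolding computes_wp prog_nth body_succs_def by (simp add: wp_simps)
next
  case (Cons p rest)
  obtain t where t: "t \<le> (60 * n + 80) * length rest + 10"
      "\<And>Q. wp prog [enc_state rest, enc_state s] (prog ! f_succs) Q
         \<longleftrightarrow> Q (enc_list enc_state (succs rest s)) t"
      using computesE[OF Cons.IH] Cons.prems by auto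
  obtain t' where t': "t' \<le> 30 * length (succs rest s) + 10"
      "\<And>Q. wp prog [enc_vertex p, enc_list enc_state (succs rest s)] (prog ! f_consall) Q
         \<longleftrightarrow> Q (enc_list enc_state (map ((#) p) (succs rest s))) t'"
      using computesE[OF computes_consall] by blast
  obtain t'' where t'': "t'' \<le> 30 * length (snd p) + 10"
      "\<And>Q. wp prog [enc_list enc_bool (snd p), enc_state s] (prog ! f_restrict) Q
         \<longleftrightarrow> Q (enc_list enc_bool (restrict (snd p) s)) t''"
      using computesE[OF computes_restrict] by blast
  have "length (snd p) \<le> n" "length (succs rest s) \<le> n"
    using Cons.prems length_succs[of rest s] by auto
  then show ?case
    unfolding computes_wp prog_nth(6) body_succs_def
    \<comment> \<open>\<open>enc_vertex\<close> is unfolded only in the second pass, because the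
      rule for \<open>f_consall\<close> matches it folded.\<close>
    using t t' t'' by (simp add: wp_simps algebra_simps) (simp add: enc_vertex_def wp_simps)
qed

lemma computes_flags:
  "computes f_flags [enc_state s] (enc_list enc_bool (map fst s)) (30 * length s + 10)"
proof (induction s)
  case Nil
  show ?case unfolding computes_wp prog_nth body_flags_def by (simp add: wp_simps)
next
  case (Cons p s)
  obtain t where t: "t \<le> 30 * length s + 10"
      "\<And>Q. wp prog [enc_state s] (prog ! f_flags) Q \<longleftrightarrow> Q (enc_list enc_bool (map fst s)) t"
      using computesE[OF Cons.IH] by blast
  show ?case
    unfolding computes_wp prog_nth(7) body_flags_def using t by (simp add: wp_simps enc_vertex_def)
qed

text \<open>The comparison never descends below the first tree, so the size of that tree alone
  bounds the time.\<close>

lemma computes_eq: "computes f_eq [a, b] (enc_bool (a = b)) (60 * size a + 30)"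
proof (induction a arbitrary: b)
  case Atom
  show ?case unfolding computes_wp prog_nth body_eq_def by (cases b) (simp_all add: wp_simps)
next
  case (Cell x y)
  show ?case
  proof (cases b)
    case Atom
    then show ?thesis unfolding computes_wp prog_nth body_eq_def by (simp add: wp_simps)
  next
    case b: (Cell x' y')
    obtain t where t: "t \<le> 60 * size x + 30"
      "\<And>Q. wp prog [x, x'] (prog ! f_eq) Q \<longleftrightarrow> Q (enc_bool (x = x')) t"
      using computesE[OF Cell.IH(1)] by blast
    obtain t' where t': "t' \<le> 60 * size y + 30"
      "\<And>Q. wp prog [y, y'] (prog ! f_eq) Q \<longleftrightarrow> Q (enc_bool (y = y')) t'"
      using computesE[OF Cell.IH(2)] by blast
    show ?thesis
      unfolding computes_wp prog_nth(8) body_eq_def using t t' by (auto simp: b wp_simps)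
  qed
qed

lemma computes_mem:
  "computes f_mem [enc_key c, enc_list enc_entry L] (enc_bool (c \<in> fst ` set L))
    ((60 * size (enc_key c) + 50) * length L + 10)"
proof (induction L)
  case Nil
  show ?case unfolding computes_wp prog_nth body_mem_def by (simp add: wp_simps)
next
  case (Cons e L)
  obtain t where t: "t \<le> (60 * size (enc_key c) + 50) * length L + 10"
      "\<And>Q. wp prog [enc_key c, enc_list enc_entry L] (prog ! f_mem) Q
         \<longleftrightarrow> Q (enc_bool (c \<in> fst ` set L)) t"
      using computesE[OF Cons.IH] by blast
  obtain t' where t': "t' \<le> 60 * size (enc_key c) + 30"
      "\<And>Q. wp prog [enc_key c, enc_key (fst e)] (prog ! f_eq) Q \<longleftrightarrow> Q (enc_bool (c = fst e)) t'"
      using computesE[OF computes_eq[of "enc_key c" "enc_key (fst e)"]] by auto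
  show ?case
    unfolding computes_wp prog_nth(9) body_mem_def
    using t t' by (auto simp: wp_simps enc_entry_def)
qed

text \<open>Lists only grow within a round, so a bound on the final length covers every list scanned
  by \<open>f_mem\<close> on the way.\<close>

lemma length_add_states: "length L \<le> length (add_states K ss L)"
proof (induction ss arbitrary: L)
  case (Cons s ss)
  show ?case unfolding add_states.simps by (rule order_trans[OF _ Cons.IH]) (simp add: Let_def)
qed simp

lemma length_expand: "length L \<le> length (expand K es L)"
proof (induction es arbitrary: L)
  case (Cons e es)
  show ?case unfolding expand.simps
    by (rule order_trans[OF length_add_states Cons.IH])
qed simp

definition dims :: "nat \<Rightarrow> state \<Rightarrow> bool" where
  "dims n s \<longleftrightarrow> length s = n \<and> (\<forall>p\<in>set s. length (snd p) = n)"

text \<open>The summands pay for the cost, the flags, a search among at most \<open>l\<close>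
  entries for a key of size at most \<open>2 * n + K + 1\<close>, and overhead.\<close>

definition add_time :: "nat \<Rightarrow> nat \<Rightarrow> nat \<Rightarrow> nat" where
  "add_time n K l = (30 * n + 40) * n + 30 * n + (60 * (2 * n + K + 1) + 50) * l + 100"

lemma computes_add:
  assumes "\<forall>s\<in>set ss. dims n s" "length (add_states K ss L) \<le> l"
  shows "computes f_add [enc_list enc_state ss, enc_list enc_entry L, un K]
    (enc_list enc_entry (add_states K ss L)) (add_time n K l * length ss + 10)"
  using assms
proof (induction ss arbitrary: L)
  case Nil
  show ?case unfolding computes_wp prog_nth body_add_def by (simp add: wp_simps)
next
  case (Cons s ss)
  define c where "c = (map fst s, K - cost s s)"
  define L' where "L' = (if snd c = 0 \<or> c \<in> fst ` set L then L else (c, s) # L)"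
  have L': "add_states K (s # ss) L = add_states K ss L'"
    by (simp add: L'_def c_def Let_def)
  have s: "length s = n" "\<forall>p\<in>set s. length (snd p) \<le> n" using Cons.prems by (auto simp: dims_def)
  obtain t1 where t1: "t1 \<le> (30 * n + 40) * n + 10"
      "\<And>Q. wp prog [enc_state s, enc_state s, un K] (prog ! f_budget) Q
         \<longleftrightarrow> Q (un (K - cost s s)) t1"
      using computesE[OF computes_budget[OF s(2)]] s(1) by metis
  obtain t2 where t2: "t2 \<le> 30 * n + 10"
      "\<And>Q. wp prog [enc_state s] (prog ! f_flags) Q \<longleftrightarrow> Q (enc_list enc_bool (map fst s)) t2"
      using computesE[OF computes_flags] s(1) by metis
  obtain t3 where t3: "t3 \<le> (60 * size (enc_key c) + 50) * length L + 10"
      "\<And>Q. wp prog [enc_key c, enc_list enc_entry L] (prog ! f_mem) Q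
         \<longleftrightarrow> Q (enc_bool (c \<in> fst ` set L)) t3"
      using computesE[OF computes_mem] by blast
  obtain t4 where t4: "t4 \<le> add_time n K l * length ss + 10"
      "\<And>Q. wp prog [enc_list enc_state ss, enc_list enc_entry L', un K] (prog ! f_add) Q
         \<longleftrightarrow> Q (enc_list enc_entry (add_states K ss L')) t4"
      using computesE[OF Cons.IH[of L']] Cons.prems unfolding L' by auto
  have "size (enc_key c) \<le> 2 * n + K + 1"
    using size_enc_bools[of "map fst s"] s(1) by (simp add: enc_key_def c_def)
  moreover have "length L \<le> l"
    using length_add_states[of L K "s # ss"] Cons.prems(2) by linarith
  ultimately have "(60 * size (enc_key c) + 50) * length L \<le> (60 * (2 * n + K + 1) + 50) * l"
    by (intro mult_mono add_mono) auto
  then have total: "t1 + t2 + t3 + t4 + 50 \<le> add_time n K l * length (s # ss) + 10"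
    using t1(1) t2(1) t3(1) t4(1) unfolding add_time_def by simp
  have key: "Cell (enc_list enc_bool (map fst s)) (un (K - cost s s)) = enc_key c"
    by (simp add: c_def enc_key_def)
  have entry: "Cell (enc_key c) (enc_state s) = enc_entry (c, s)" by (simp add: enc_entry_def)
  consider "K \<le> cost s s" "L' = L" | "\<not> K \<le> cost s s" "c \<in> fst ` set L" "L' = L"
    | "\<not> K \<le> cost s s" "c \<notin> fst ` set L" "L' = (c, s) # L"
    by (cases "K \<le> cost s s"; cases "c \<in> fst ` set L") (simp_all add: L'_def c_def)
  then show ?case
    unfolding computes_wp prog_nth(10) body_add_def L'
    using total t4(2) by cases (simp_all add: wp_simps t1(2) t2(2) key t3(2) entry)
qed

lemma dims_succs:
  assumes "dims n s" "s' \<in> set (succs s s)" shows "dims n s'"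
proof -
  have "length s' = length rest \<and> (\<forall>p\<in>set s'. length (snd p) = n)"
    if "s' \<in> set (succs rest s)" "\<forall>p\<in>set rest. length (snd p) = n" for rest s'
    using that
  proof (induction rest arbitrary: s')
    case (Cons p rest)
    from Cons.prems(1) consider "s' = (True, restrict (snd p) s) # rest"
      | s'' where "s' = p # s''" "s'' \<in> set (succs rest s)" by (auto split: if_splits)
    then show ?case
    proof cases
      case 1
      then show ?thesis using Cons.prems(2) assms(1) by (auto simp: restrict_def dims_def)
    next
      case 2
      then show ?thesis using Cons.IH[of s''] Cons.prems(2) by auto
    qed
  qed simp
  then show ?thesis using assms by (auto simp: dims_def)
qed

definition expand_time :: "nat \<Rightarrow> nat \<Rightarrow> nat \<Rightarrow> nat" where
  "expand_time n K l = (60 * n + 80) * n + add_time n K l * n + 60"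

lemma computes_expand:
  assumes "\<forall>e\<in>set es. dims n (snd e)" "length (expand K es L) \<le> l"
  shows "computes f_expand [enc_list enc_entry es, enc_list enc_entry L, un K]
    (enc_list enc_entry (expand K es L)) (expand_time n K l * length es + 10)"
  using assms
proof (induction es arbitrary: L)
  case Nil
  show ?case unfolding computes_wp prog_nth body_expand_def by (simp add: wp_simps)
next
  case (Cons e es)
  define s where "s = snd e"
  define L' where "L' = add_states K (succs s s) L"
  have e: "enc_entry e = Cell (enc_key (fst e)) (enc_state s)" by (simp add: enc_entry_def s_def)
  have L': "expand K (e # es) L = expand K es L'" by (simp add: L'_def s_def)
  have s: "dims n s" "\<forall>p\<in>set s. length (snd p) \<le> n" "length s = n" "length s \<le> n"
    using Cons.prems by (auto simp: dims_def s_def)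
  have len: "length (add_states K (succs s s) L) \<le> l"
    using length_expand[of L' K es] Cons.prems(2) unfolding L' by (simp add: L'_def)
  obtain t1 where t1: "t1 \<le> (60 * n + 80) * n + 10"
      "\<And>Q. wp prog [enc_state s, enc_state s] (prog ! f_succs) Q
         \<longleftrightarrow> Q (enc_list enc_state (succs s s)) t1"
      using computesE[OF computes_succs[OF s(2,4)]] s(3) by metis
  obtain t2 where t2: "t2 \<le> add_time n K l * length (succs s s) + 10"
      "\<And>Q. wp prog [enc_list enc_state (succs s s), enc_list enc_entry L, un K] (prog ! f_add) Q
         \<longleftrightarrow> Q (enc_list enc_entry L') t2"
      using computesE[OF computes_add[OF _ len]] dims_succs[OF s(1)] unfolding L'_def by blast
  obtain t3 where t3: "t3 \<le> expand_time n K l * length es + 10"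
      "\<And>Q. wp prog [enc_list enc_entry es, enc_list enc_entry L', un K] (prog ! f_expand) Q
         \<longleftrightarrow> Q (enc_list enc_entry (expand K es L')) t3"
      using computesE[OF Cons.IH[of L']] Cons.prems unfolding L' by auto
  have "add_time n K l * length (succs s s) \<le> add_time n K l * n"
    using length_succs[of s s] s(3) by (intro mult_left_mono) auto
  then have "t1 + t2 + t3 + 30 \<le> expand_time n K l * length (e # es) + 10"
    using t1(1) t2(1) t3(1) unfolding expand_time_def length_Cons mult_Suc_right by linarith
  then show ?case
    unfolding computes_wp prog_nth(11) body_expand_def L'
    by (simp add: wp_simps e t1(2) t2(2) t3(2))
qed

text \<open>Only the length of \<open>xs\<close> matters, as the number of rounds. All iterates are
  constrained because a round takes time depending on both the layer it reads and the one it
  builds.\<close>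

lemma computes_iter:
  assumes "\<forall>j\<le>length xs. length (((\<lambda>L. expand K L []) ^^ j) L) \<le> l"
    and "\<forall>j\<le>length xs. \<forall>e\<in>set (((\<lambda>L. expand K L []) ^^ j) L). dims n (snd e)"
  shows "computes f_iter [enc_list f xs, enc_list enc_entry L, un K]
    (enc_list enc_entry (((\<lambda>L. expand K L []) ^^ length xs) L))
    ((expand_time n K l * l + 40) * length xs + 10)"
  using assms
proof (induction xs arbitrary: L)
  case Nil
  show ?case unfolding computes_wp prog_nth body_iter_def by (simp add: wp_simps)
next
  case (Cons x xs)
  define L' where "L' = expand K L []"
  have step: "((\<lambda>L. expand K L []) ^^ j) L' = ((\<lambda>L. expand K L []) ^^ Suc j) L" for j
    by (simp only: L'_def funpow_Suc_right comp_def)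
  have len: "length L \<le> l" "length (expand K L []) \<le> l"
    using Cons.prems(1)[rule_format, of 0] Cons.prems(1)[rule_format, of 1] by auto
  have dims: "\<forall>e\<in>set L. dims n (snd e)" using Cons.prems(2)[rule_format, of 0] by simp
  obtain t1 where t1: "t1 \<le> expand_time n K l * length L + 10"
      "\<And>Q. wp prog [enc_list enc_entry L, Atom, un K] (prog ! f_expand) Q
         \<longleftrightarrow> Q (enc_list enc_entry L') t1"
      using computesE[OF computes_expand[OF dims len(2)]] unfolding L'_def enc_list.simps by blast
  obtain t2 where t2: "t2 \<le> (expand_time n K l * l + 40) * length xs + 10"
      "\<And>Q. wp prog [enc_list f xs, enc_list enc_entry L', un K] (prog ! f_iter) Q
         \<longleftrightarrow> Q (enc_list enc_entry (((\<lambda>L. expand K L []) ^^ length xs) L')) t2"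
  proof (rule computesE[OF Cons.IH[of L']])
    show "\<forall>j\<le>length xs. length (((\<lambda>L. expand K L []) ^^ j) L') \<le> l"
      unfolding step using Cons.prems(1) by auto
    show "\<forall>j\<le>length xs. \<forall>e\<in>set (((\<lambda>L. expand K L []) ^^ j) L'). dims n (snd e)"
      unfolding step using Cons.prems(2) by (metis Suc_le_mono length_Cons)
  qed blast
  have "expand_time n K l * length L \<le> expand_time n K l * l"
    using len(1) by (intro mult_left_mono) auto
  then have "t1 + t2 + 30 \<le> (expand_time n K l * l + 40) * length (x # xs) + 10"
    using t1(1) t2(1) unfolding length_Cons mult_Suc_right by linarith
  then show ?case
    unfolding computes_wp prog_nth(12) body_iter_def length_Cons step[symmetric]
    by (simp add: wp_simps t1(2) t2(2))
qed

section \<open>Conversion of input and output, and assembly of the program\<close>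

lemma computes_init:
  "computes f_init [enc_list (enc_list enc_bool) M] (enc_state (map (Pair False) M))
    (30 * length M + 10)"
proof (induction M)
  case Nil
  show ?case unfolding computes_wp prog_nth body_init_def by (simp add: wp_simps)
next
  case (Cons r M)
  obtain t where t: "t \<le> 30 * length M + 10"
      "\<And>Q. wp prog [enc_list (enc_list enc_bool) M] (prog ! f_init) Q
        \<longleftrightarrow> Q (enc_state (map (Pair False) M)) t"
      using computesE[OF Cons.IH] by blast
  show ?case
    unfolding computes_wp prog_nth(13) body_init_def using t by (simp add: wp_simps enc_vertex_def)
qed

lemma computes_rows:
  "computes f_rows [enc_state s] (enc_list (enc_list enc_bool) (map snd s)) (30 * length s + 10)"
proof (induction s)
  case Nil
  show ?case unfolding computes_wp prog_nth body_rows_def by (simp add: wp_simps)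
next
  case (Cons p s)
  obtain t where t: "t \<le> 30 * length s + 10"
      "\<And>Q. wp prog [enc_state s] (prog ! f_rows) Q
        \<longleftrightarrow> Q (enc_list (enc_list enc_bool) (map snd s)) t"
      using computesE[OF Cons.IH] by blast
  show ?case
    unfolding computes_wp prog_nth(14) body_rows_def using t by (simp add: wp_simps enc_vertex_def)
qed

lemma computes_dbl: "computes f_dbl [un k] (un (2 * k)) (30 * k + 10)"
proof (induction k)
  case 0
  show ?case unfolding computes_wp prog_nth body_dbl_def by (simp add: wp_simps)
next
  case (Suc k)
  obtain t where t: "t \<le> 30 * k + 10"
      "\<And>Q. wp prog [un k] (prog ! f_dbl) Q \<longleftrightarrow> Q (un (2 * k)) t"
      using computesE[OF Suc.IH] by blast
  show ?case
    unfolding computes_wp prog_nth(15) body_dbl_def using t by (simp add: wp_simps)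
qed

text \<open>Horner's scheme: \<open>k\<close> is halved at each level, so the doublings add up
  geometrically. The time is linear in \<open>k\<close> rather than in its binary length, which the
  final bound absorbs.\<close>

lemma computes_unary: "computes f_unary [enc_nat k] (un k) (100 * k + 10)"
proof (induction k rule: less_induct)
  case (less k)
  show ?case
  proof (cases "k = 0")
    case True
    then show ?thesis unfolding computes_wp prog_nth body_unary_def
      by (simp add: wp_simps enc_nat_def binary.simps)
  next
    case False
    obtain t where t: "t \<le> 100 * (k div 2) + 10"
        "\<And>Q. wp prog [enc_nat (k div 2)] (prog ! f_unary) Q \<longleftrightarrow> Q (un (k div 2)) t"
        using computesE[OF less.IH[of "k div 2"]] False by auto
    obtain t' where t': "t' \<le> 30 * (k div 2) + 10"
        "\<And>Q. wp prog [un (k div 2)] (prog ! f_dbl) Q \<longleftrightarrow> Q (un (2 * (k div 2))) t'"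
        using computesE[OF computes_dbl] by blast
    have k: "enc_nat k = Cell (enc_bool (odd k)) (enc_nat (k div 2))"
      using False by (simp add: enc_nat_def binary.simps[of k])
    have odd: "Cell Atom (un (k - Suc 0)) = un k" using False by (cases k) auto
    have even: "2 * (k div 2) = k" if "even k" using that by simp
    have "2 * (k div 2) \<le> k" by simp
    then have "130 * (k div 2) + 80 \<le> 100 * k + 10"
      using False by (cases "k div 2 = 0") linarith+
    then have "t + t' + 50 \<le> 100 * k + 10" using t(1) t'(1) by linarith
    then show ?thesis
      unfolding computes_wp prog_nth(16) body_unary_def
      by (cases "odd k") (simp_all add: k wp_simps t(2) t'(2) odd even)
  qed
qed

definition initial :: "bool list list \<Rightarrow> nat \<Rightarrow> layer" where
  "initial M K = [((replicate (length M) False, K), map (Pair False) M)]"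

definition layers :: "bool list list \<Rightarrow> nat \<Rightarrow> nat \<Rightarrow> layer" where
  "layers M K j = ((\<lambda>L. expand K L []) ^^ j) (initial M K)"

definition answer :: "layer \<Rightarrow> bool list list option" where
  "answer L = (case L of [] \<Rightarrow> None | e # _ \<Rightarrow> Some (map snd (snd e)))"

lemma runs_prog:
  assumes "\<forall>j\<le>length M. length (layers M (Suc k) j) \<le> l"
    and "\<forall>j\<le>length M. \<forall>e\<in>set (layers M (Suc k) j). dims (length M) (snd e)"
  shows "\<exists>t\<le>(expand_time (length M) (Suc k) l * l + 200) * length M + 100 * k + 200.
    runs prog [enc_list (enc_list enc_bool) M, enc_nat k]
      (enc_option (enc_list (enc_list enc_bool)) (answer (layers M (Suc k) (length M)))) t"
proof -
  define L where "L = layers M (Suc k) (length M)"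
  obtain t1 where t1: "t1 \<le> 100 * k + 10"
    "\<And>Q. wp prog [enc_nat k] (prog ! f_unary) Q \<longleftrightarrow> Q (un k) t1"
    using computesE[OF computes_unary] by blast
  obtain t2 where t2: "t2 \<le> 30 * length M + 10"
    "\<And>Q. wp prog [enc_list (enc_list enc_bool) M] (prog ! f_init) Q
        \<longleftrightarrow> Q (enc_state (map (Pair False) M)) t2"
    using computesE[OF computes_init] by blast
  obtain t3 where t3: "t3 \<le> 30 * length M + 10"
    "\<And>Q. wp prog [enc_state (map (Pair False) M)] (prog ! f_flags) Q
        \<longleftrightarrow> Q (enc_list enc_bool (replicate (length M) False)) t3"
    using computesE[OF computes_flags[of "map (Pair False) M"]]
    by (auto simp: comp_def map_replicate_const)
  obtain t4 where t4: "t4 \<le> (expand_time (length M) (Suc k) l * l + 40) * length M + 10"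
    "\<And>Q. wp prog [enc_list (enc_list enc_bool) M, enc_list enc_entry (initial M (Suc k)), un (Suc k)]
       (prog ! f_iter) Q \<longleftrightarrow> Q (enc_list enc_entry L) t4"
    using computesE[OF computes_iter[of M "Suc k" "initial M (Suc k)" l "length M"]] assms
    unfolding L_def layers_def by blast
  have init: "Cell (Cell (Cell (enc_list enc_bool (replicate (length M) False)) (Cell Atom (un k)))
      (enc_state (map (Pair False) M))) Atom = enc_list enc_entry (initial M (Suc k))"
    by (simp add: initial_def enc_entry_def enc_key_def)
  have "wp prog [enc_list (enc_list enc_bool) M, enc_nat k] body_main
    (\<lambda>x t. x = enc_option (enc_list (enc_list enc_bool)) (answer L) \<and>
       t \<le> (expand_time (length M) (Suc k) l * l + 200) * length M + 100 * k + 200)"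
  proof (cases L)
    case Nil
    then show ?thesis
      unfolding body_main_def using t1(1) t2(1) t3(1) t4(1) t4(2)
      by (simp add: wp_simps t1(2) t2(2) t3(2) init answer_def algebra_simps)
  next
    case (Cons e L')
    have e: "enc_entry e = Cell (enc_key (fst e)) (enc_state (snd e))" by (simp add: enc_entry_def)
    have "e \<in> set L" by (simp add: Cons)
    then have "length (snd e) = length M" using assms(2) by (auto simp: L_def dims_def)
    then obtain t5 where t5: "t5 \<le> 30 * length M + 10"
      "\<And>Q. wp prog [enc_state (snd e)] (prog ! f_rows) Q
        \<longleftrightarrow> Q (enc_list (enc_list enc_bool) (map snd (snd e))) t5"
      using computesE[OF computes_rows] by metis
    show ?thesis
      unfolding body_main_def using t1(1) t2(1) t3(1) t4(1) t5(1) t4(2)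
      by (simp add: wp_simps t1(2) t2(2) t3(2) init answer_def Cons e t5(2) algebra_simps)
  qed
  then show ?thesis by (auto simp: wp_def runs_def prog_nth L_def prog_def[THEN arg_cong[of _ _ "\<lambda>x. x \<noteq> []"]])
qed

section \<open>Correctness of the dynamic program\<close>

lemma add_states_sound:
  "e \<in> set (add_states K ss L) \<Longrightarrow>
   e \<in> set L \<or> (\<exists>s\<in>set ss. e = ((map fst s, K - cost s s), s) \<and> cost s s < K)"
proof (induction ss arbitrary: L)
  case (Cons s ss)
  from Cons.IH[OF Cons.prems[unfolded add_states.simps]] show ?case
    by (auto simp: Let_def split: if_splits)
qed simp

lemma add_states_mono: "fst ` set L \<subseteq> fst ` set (add_states K ss L)"
proof (induction ss arbitrary: L)
  case (Cons s ss)
  show ?case unfolding add_states.simps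
    by (rule subset_trans[OF _ Cons.IH]) (auto simp: Let_def)
qed simp

text \<open>Only the key is guaranteed to occur, since another state with the same key may have been
  recorded in place of \<open>s\<close>.\<close>

lemma add_states_complete:
  "s \<in> set ss \<Longrightarrow> cost s s < K \<Longrightarrow> (map fst s, K - cost s s) \<in> fst ` set (add_states K ss L)"
proof (induction ss arbitrary: L)
  case (Cons s' ss)
  show ?case
  proof (cases "s = s'")
    case True
    have "(map fst s, K - cost s s) \<in> fst ` set (let c = (map fst s, K - cost s s)
        in if snd c = 0 \<or> c \<in> fst ` set L then L else (c, s) # L)"
      using Cons.prems(2) by (auto simp: Let_def)
    then show ?thesis
      unfolding True add_states.simps by (rule subsetD[OF add_states_mono])
  next
    case False
    then show ?thesis using Cons by simp
  qed
qed simp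

lemma add_states_distinct:
  "distinct (map fst L) \<Longrightarrow> distinct (map fst (add_states K ss L))"
  by (induction ss arbitrary: L) (auto simp: Let_def)

lemma expand_sound:
  "e \<in> set (expand K es L) \<Longrightarrow>
   e \<in> set L \<or> (\<exists>e'\<in>set es. \<exists>s\<in>set (succs (snd e') (snd e')).
      e = ((map fst s, K - cost s s), s) \<and> cost s s < K)"
proof (induction es arbitrary: L)
  case (Cons e' es)
  from Cons.IH[OF Cons.prems[unfolded expand.simps]] show ?case
    using add_states_sound[of e K "succs (snd e') (snd e')" L] by auto
qed simp

lemma expand_mono: "fst ` set L \<subseteq> fst ` set (expand K es L)"
proof (induction es arbitrary: L)
  case (Cons e es)
  show ?case unfolding expand.simps by (rule subset_trans[OF add_states_mono Cons.IH])
qed simp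

lemma expand_complete:
  "e \<in> set es \<Longrightarrow> s \<in> set (succs (snd e) (snd e)) \<Longrightarrow> cost s s < K \<Longrightarrow>
   (map fst s, K - cost s s) \<in> fst ` set (expand K es L)"
proof (induction es arbitrary: L)
  case (Cons e' es)
  show ?case
  proof (cases "e = e'")
    case True
    then have "(map fst s, K - cost s s) \<in> fst ` set (add_states K (succs (snd e') (snd e')) L)"
      using Cons.prems by (intro add_states_complete) auto
    then show ?thesis unfolding expand.simps by (rule subsetD[OF expand_mono])
  next
    case False
    then show ?thesis using Cons by simp
  qed
qed simp

lemma expand_distinct: "distinct (map fst L) \<Longrightarrow> distinct (map fst (expand K es L))"
  by (induction es arbitrary: L) (auto simp: add_states_distinct)

lemma set_succs:
  "set (succs rest s) =
   {rest[i := (True, restrict (snd (rest ! i)) s)] | i. i < length rest \<and> \<not> fst (rest ! i)}"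
proof (induction rest)
  case (Cons p rest)
  have "{(p # rest)[i := (True, restrict (snd ((p # rest) ! i)) s)] | i.
      i < length (p # rest) \<and> \<not> fst ((p # rest) ! i)} =
    (if fst p then {} else {(True, restrict (snd p) s) # rest}) \<union>
    (#) p ` {rest[i := (True, restrict (snd (rest ! i)) s)] | i. i < length rest \<and> \<not> fst (rest ! i)}"
    (is "?L = ?A \<union> ?B")
  proof (intro equalityI subsetI)
    fix x assume "x \<in> ?L"
    then obtain i where i: "x = (p # rest)[i := (True, restrict (snd ((p # rest) ! i)) s)]"
      "i < length (p # rest)" "\<not> fst ((p # rest) ! i)" by auto
    then show "x \<in> ?A \<union> ?B" by (cases i) auto
  next
    fix x assume "x \<in> ?A \<union> ?B"
    then consider "x = (True, restrict (snd p) s) # rest" "\<not> fst p"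
      | i where "x = p # rest[i := (True, restrict (snd (rest ! i)) s)]" "i < length rest" "\<not> fst (rest ! i)"
      by (auto split: if_splits)
    then show "x \<in> ?L"
    proof cases
      case 1
      then show ?thesis by (intro CollectI exI[of _ 0]) auto
    next
      case (2 i)
      then show ?thesis by (intro CollectI exI[of _ "Suc i"]) auto
    qed
  qed
  then show ?case by (simp add: Cons.IH)
qed simp

section \<open>States as sets of vertices and arcs\<close>

definition mk :: "nat \<Rightarrow> nat set \<Rightarrow> (nat \<times> nat) set \<Rightarrow> state" where
  "mk n X R = map (\<lambda>u. (u \<in> X, map (\<lambda>w. (u, w) \<in> R) [0..<n])) [0..<n]"

lemma dims_mk: "dims n (mk n X R)"
  by (auto simp: dims_def mk_def)

lemma map_fst_mk: "map fst (mk n X R) = map (\<lambda>u. u \<in> X) [0..<n]"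
  by (simp add: mk_def)

lemma map_mem_eq_iff:
  assumes "X \<subseteq> {..<n}" "Y \<subseteq> {..<n}"
  shows "map (\<lambda>u. u \<in> X) [0..<n] = map (\<lambda>u. u \<in> Y) [0..<n] \<longleftrightarrow> X = Y"
  using assms by (auto simp: map_eq_conv)

lemma set_succs_mk:
  "set (succs (mk n X R) (mk n X R)) =
   {mk n (insert v X) (R - {v} \<times> (- X)) | v. v < n \<and> v \<notin> X}"
proof -
  have "(mk n X R)[v := (True, restrict (snd (mk n X R ! v)) (mk n X R))] =
      mk n (insert v X) (R - {v} \<times> (- X))" if "v < n" for v
  proof (rule nth_equalityI)
    show "length ((mk n X R)[v := (True, restrict (snd (mk n X R ! v)) (mk n X R))]) =
      length (mk n (insert v X) (R - {v} \<times> (- X)))" by (simp add: mk_def)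
    have r: "restrict (snd (mk n X R ! v)) (mk n X R) = map (\<lambda>w. (v, w) \<in> R \<and> w \<in> X) [0..<n]"
      using that by (auto simp: restrict_def mk_def intro!: nth_equalityI)
    fix i assume "i < length ((mk n X R)[v := (True, restrict (snd (mk n X R ! v)) (mk n X R))])"
    then have "i < n" by (simp add: mk_def)
    then show "(mk n X R)[v := (True, restrict (snd (mk n X R ! v)) (mk n X R))] ! i =
      mk n (insert v X) (R - {v} \<times> (- X)) ! i"
      unfolding r by (cases "i = v") (auto simp: mk_def nth_list_update)
  qed
  moreover have "fst (mk n X R ! v) \<longleftrightarrow> v \<in> X" if "v < n" for v using that by (simp add: mk_def)
  moreover have "length (mk n X R) = n" by (simp add: mk_def)
  ultimately show ?thesis unfolding set_succs by (intro Collect_cong) (metis (no_types, lifting))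
qed

lemma overlap_map:
  "distinct us \<Longrightarrow> overlap (map f us) (map g us) = card {w \<in> set us. f w \<and> fst (g w)}"
proof -
  assume d: "distinct us"
  have "overlap (map f us) (map g us) = length (filter (\<lambda>w. f w \<and> fst (g w)) us)"
    by (induction us) auto
  also have "\<dots> = card {w \<in> set us. f w \<and> fst (g w)}"
    using d by (metis distinct_card distinct_filter set_filter)
  finally show ?thesis .
qed

text \<open>Double counting by tails. Under \<open>partial\<close>, the counted arcs are those
  entering \<open>X\<close> from outside and those of \<open>R\<close> inside \<open>X\<close>, that
  is, the cost of the partial order.\<close>

lemma cost_mk:
  assumes "R \<subseteq> {..<n} \<times> {..<n}"
  shows "cost (mk n X R) (mk n X R) = card (R \<inter> UNIV \<times> X)"
proof -
  have "cost (mk n X R) (mk n X R) = (\<Sum>u\<leftarrow>[0..<n]. card {w \<in> set [0..<n]. (u, w) \<in> R \<and> w \<in> X})"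
    unfolding cost_def mk_def by (simp add: overlap_map comp_def)
  also have "\<dots> = (\<Sum>u\<in>{..<n}. card {w \<in> {..<n}. (u, w) \<in> R \<and> w \<in> X})"
    by (simp add: interv_sum_list_conv_sum_set_nat atLeast0LessThan)
  also have "\<dots> = card (SIGMA u:{..<n}. {w \<in> {..<n}. (u, w) \<in> R \<and> w \<in> X})" by simp
  also have "(SIGMA u:{..<n}. {w \<in> {..<n}. (u, w) \<in> R \<and> w \<in> X}) = R \<inter> UNIV \<times> X"
    using assms by auto
  finally show ?thesis .
qed

text \<open>\<open>X\<close> is the set of vertices placed so far, and \<open>R\<close> the arcs not yet known to point forward.\<close>

definition partial :: "nat \<Rightarrow> (nat \<times> nat) set \<Rightarrow> nat set \<Rightarrow> (nat \<times> nat) set \<Rightarrow> bool" where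
  "partial n A X R \<longleftrightarrow> X \<subseteq> {..<n} \<and> R \<subseteq> A \<and> (\<forall>u w. (u, w) \<in> A \<longrightarrow> u \<notin> X \<longrightarrow> (u, w) \<in> R) \<and>
     (\<forall>u w. (u, w) \<in> R \<longrightarrow> u \<in> X \<longrightarrow> w \<in> X) \<and> acyclic (A - R)"

text \<open>The head of an arc of \<open>S\<close> has no outgoing arc, so a path can use such an
  arc only as its last step and no cycle can use it at all.\<close>

lemma acyclic_add_sinks:
  assumes "acyclic B" and sink: "\<And>u w x. (u, w) \<in> S \<Longrightarrow> (w, x) \<notin> B \<union> S"
  shows "acyclic (B \<union> S)"
proof -
  have "(a, b) \<in> B\<^sup>+ \<or> (\<exists>u. (u, b) \<in> S)" if "(a, b) \<in> (B \<union> S)\<^sup>+" for a b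
    using that
  proof (induction rule: trancl_induct)
    case (base y)
    then show ?case by auto
  next
    case (step y z)
    then have "(a, y) \<in> B\<^sup>+" using sink by blast
    then show ?case using step.hyps(2) by (auto intro: trancl_into_trancl)
  qed
  moreover have "(b, c) \<notin> (B \<union> S)\<^sup>+" if "(u, b) \<in> S" for u b c
  proof
    assume "(b, c) \<in> (B \<union> S)\<^sup>+"
    then obtain x where "(b, x) \<in> B \<union> S" by (meson tranclD)
    then show False using sink that by blast
  qed
  ultimately show ?thesis using assms(1) unfolding acyclic_def by blast
qed

lemma partial_step:
  assumes A: "irrefl A" and P: "partial n A X R" and v: "v < n" "v \<notin> X"
  shows "partial n A (insert v X) (R - {v} \<times> (- X))"
proof -
  have R: "X \<subseteq> {..<n}" "R \<subseteq> A" "\<And>u w. (u, w) \<in> A \<Longrightarrow> u \<notin> X \<Longrightarrow> (u, w) \<in> R"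
    "\<And>u w. (u, w) \<in> R \<Longrightarrow> u \<in> X \<Longrightarrow> w \<in> X" "acyclic (A - R)"
    using P by (auto simp: partial_def)
  have "A - (R - {v} \<times> (- X)) = (A - R) \<union> (A \<inter> {v} \<times> (- X))" by auto
  moreover have "acyclic ((A - R) \<union> (A \<inter> {v} \<times> (- X)))"
  proof (rule acyclic_add_sinks[OF R(5)])
    fix u w x assume uw: "(u, w) \<in> A \<inter> {v} \<times> (- X)"
    then have "w \<noteq> v" "w \<notin> X" using A by (auto simp: irrefl_def)
    \<comment> \<open>\<open>w\<close> is unplaced, so all its arcs are still in \<open>R\<close>,
      and the newly released arcs start at \<open>v\<close>, not at \<open>w\<close>.\<close>
    then show "(w, x) \<notin> (A - R) \<union> (A \<inter> {v} \<times> (- X))" using R(3) by auto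
  qed
  ultimately show ?thesis using R(1-4) v by (auto simp: partial_def)
qed

lemma partial_final:
  assumes "partial n A {..<n} R" "A \<subseteq> {..<n} \<times> {..<n}"
  shows "feedback_arc_set A R" "R \<inter> UNIV \<times> {..<n} = R"
  using assms by (auto simp: partial_def feedback_arc_set_def)

section \<open>Soundness, size and completeness of the layers of a fixed tournament\<close>

locale fast =
  fixes n :: nat and A :: "(nat \<times> nat) set" and k :: nat
  assumes T: "tournament {..<n} A"
begin

lemma A: "A \<subseteq> {..<n} \<times> {..<n}" "irrefl A" "finite A"
  using T finite_subset[of A "{..<n} \<times> {..<n}"] by (auto simp: tournament_def)

definition matrix :: "bool list list" where
  "matrix = map (\<lambda>u. map (\<lambda>v. (u, v) \<in> A) [0..<n]) [0..<n]"

definition entry_ok :: "nat \<Rightarrow> (bool list \<times> nat) \<times> state \<Rightarrow> bool" where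
  "entry_ok j e \<longleftrightarrow> (\<exists>X R. partial n A X R \<and> card X = j \<and> card (R \<inter> UNIV \<times> X) \<le> k \<and>
     e = ((map (\<lambda>u. u \<in> X) [0..<n], Suc k - card (R \<inter> UNIV \<times> X)), mk n X R))"

lemma layers_0: "layers matrix (Suc k) 0 = [((map (\<lambda>u. u \<in> {}) [0..<n], Suc k), mk n {} A)]"
  by (simp add: layers_def initial_def matrix_def mk_def map_replicate_const)

lemma layers_Suc: "layers M K (Suc j) = expand K (layers M K j) []"
  by (simp add: layers_def)

lemma layers_ok: "e \<in> set (layers matrix (Suc k) j) \<Longrightarrow> entry_ok j e"
proof (induction j arbitrary: e)
  case 0
  have "partial n A {} A" by (simp add: partial_def acyclic_def)
  then show ?case using 0 by (auto simp: layers_0 entry_ok_def intro!: exI[of _ "{}"] exI[of _ A])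
next
  case (Suc j)
  from expand_sound[OF Suc.prems[unfolded layers_Suc]] obtain e' s where
    e': "e' \<in> set (layers matrix (Suc k) j)" and s: "s \<in> set (succs (snd e') (snd e'))"
      "e = ((map fst s, Suc k - cost s s), s)" "cost s s < Suc k"
    by auto
  from Suc.IH[OF e'] obtain X R where XR: "partial n A X R" "card X = j" "snd e' = mk n X R"
    by (auto simp: entry_ok_def)
  from s(1) obtain v where v: "v < n" "v \<notin> X" "s = mk n (insert v X) (R - {v} \<times> (- X))"
    unfolding XR set_succs_mk by auto
  have P: "partial n A (insert v X) (R - {v} \<times> (- X))"
    by (rule partial_step[OF A(2) XR(1) v(1,2)])
  then have "R - {v} \<times> (- X) \<subseteq> {..<n} \<times> {..<n}" using A(1) by (auto simp: partial_def)
  note c = cost_mk[OF this]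
  have "finite X" using XR(1) finite_subset[of X "{..<n}"] by (auto simp: partial_def)
  then have "card (insert v X) = Suc j" using XR(2) v(2) by simp
  then show ?case
    using P s(2,3) unfolding v(3) c map_fst_mk entry_ok_def by (metis less_Suc_eq_le)
qed

lemma layers_distinct: "distinct (map fst (layers M K j))"
proof (cases j)
  case 0 then show ?thesis by (simp add: layers_def initial_def)
next
  case (Suc i) then show ?thesis by (simp add: layers_Suc expand_distinct)
qed

text \<open>Keys are distinct, and each is a set with a budget from \<open>1\<close> to
  \<open>k + 1\<close>. All arcs entering the set are still in \<open>R\<close> and hence paid for,
  so the set is a small cut.\<close>

lemma length_layers_le:
  assumes m: "0 < m" "k \<le> m ^ 2"
  shows "length (layers matrix (Suc k) j) \<le> 2 ^ (6 * m) * Suc k"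
proof -
  let ?L = "layers matrix (Suc k) j"
  have "fst ` set ?L \<subseteq> (\<lambda>(X, b). (map (\<lambda>u. u \<in> X) [0..<n], b)) ` (small_cuts {..<n} A j k \<times> {1..Suc k})"
  proof
    fix c assume "c \<in> fst ` set ?L"
    then obtain e where e: "e \<in> set ?L" "c = fst e" by auto
    from layers_ok[OF e(1)] obtain X R where XR: "partial n A X R" "card X = j" "card (R \<inter> UNIV \<times> X) \<le> k"
      "c = (map (\<lambda>u. u \<in> X) [0..<n], Suc k - card (R \<inter> UNIV \<times> X))"
      unfolding entry_ok_def e(2) by (metis fst_conv)
    have "A \<inter> (- X) \<times> X \<subseteq> R \<inter> UNIV \<times> X" "finite R"
      using XR(1) finite_subset[OF _ A(3), of R] unfolding partial_def by blast+
    then have "card (A \<inter> (- X) \<times> X) \<le> card (R \<inter> UNIV \<times> X)" by (intro card_mono) auto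
    then have "X \<in> small_cuts {..<n} A j k"
      using XR by (auto simp: small_cuts_def partial_def)
    then have "(X, Suc k - card (R \<inter> UNIV \<times> X)) \<in> small_cuts {..<n} A j k \<times> {1..Suc k}"
      using XR(3) by auto
    then show "c \<in> (\<lambda>(X, b). (map (\<lambda>u. u \<in> X) [0..<n], b)) ` (small_cuts {..<n} A j k \<times> {1..Suc k})"
      unfolding XR(4) by force
  qed
  moreover have fin: "finite (small_cuts {..<n} A j k)"
    by (rule finite_subset[of _ "Pow {..<n}"]) (auto simp: small_cuts_def)
  ultimately have "card (fst ` set ?L) \<le> card (small_cuts {..<n} A j k \<times> {1..Suc k})"
    by (intro surj_card_le) auto
  also have "\<dots> = card (small_cuts {..<n} A j k) * Suc k"
    by (simp add: card_cartesian_product)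
  also have "\<dots> \<le> 2 ^ (6 * m) * Suc k"
    using card_small_cuts_le[OF T m] by (intro mult_right_mono) auto
  also have "card (fst ` set ?L) = length ?L"
    using layers_distinct[of matrix "Suc k" j] by (metis distinct_card length_map set_map)
  finally show ?thesis .
qed

text \<open>Placing the vertices in a topological order of \<open>A - F\<close> charges each arc paid for to an arc
  of \<open>F\<close> with the same head.\<close>

lemma layers_complete:
  assumes F: "feedback_arc_set A F" "card F \<le> k" and "j \<le> n"
  shows "\<exists>X R. partial n A X R \<and> card X = j \<and> (\<forall>u v. (u, v) \<in> A - F \<longrightarrow> v \<in> X \<longrightarrow> u \<in> X) \<and>
    card (R \<inter> UNIV \<times> X) \<le> card (F \<inter> UNIV \<times> X) \<and>
    ((map (\<lambda>u. u \<in> X) [0..<n], Suc k - card (R \<inter> UNIV \<times> X)), mk n X R) \<in> set (layers matrix (Suc k) j)"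
  using \<open>j \<le> n\<close>
proof (induction j)
  case 0
  have "partial n A {} A" by (simp add: partial_def acyclic_def)
  then show ?case by (intro exI[of _ "{}"] exI[of _ A]) (simp add: layers_0)
next
  case (Suc j)
  then obtain X R where P: "partial n A X R" and X: "card X = j"
    and down: "\<forall>u v. (u, v) \<in> A - F \<longrightarrow> v \<in> X \<longrightarrow> u \<in> X"
    and le: "card (R \<inter> UNIV \<times> X) \<le> card (F \<inter> UNIV \<times> X)"
    and e: "((map (\<lambda>u. u \<in> X) [0..<n], Suc k - card (R \<inter> UNIV \<times> X)), mk n X R) \<in> set (layers matrix (Suc k) j)"
    by auto
  have Xn: "X \<subseteq> {..<n}" "finite X" using P finite_subset[of X "{..<n}"] by (auto simp: partial_def)
  have finF: "finite F" using F(1) finite_subset[OF _ A(3), of F] unfolding feedback_arc_set_def by blast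
  \<comment> \<open>Well-foundedness supplies the next vertex \<open>v\<close>: an unplaced one that
    no unplaced vertex precedes in \<open>A - F\<close>.\<close>
  have "wf (A - F)" using F(1) A(3) by (intro finite_acyclic_wf) (auto simp: feedback_arc_set_def)
  moreover obtain x where "x \<in> {..<n} - X"
    using Suc.prems X Xn by (metis Diff_eq_empty_iff card_lessThan card_mono ex_in_conv not_less_eq_eq)
  ultimately obtain v where v: "v < n" "v \<notin> X" and min: "\<And>u. (u, v) \<in> A - F \<Longrightarrow> u \<notin> {..<n} - X"
    by (metis (no_types, lifting) DiffD1 DiffD2 lessThan_iff wfE_min)
  define Y where "Y = insert v X"
  define S where "S = R - {v} \<times> (- X)"
  have PS: "partial n A Y S" unfolding Y_def S_def by (rule partial_step[OF A(2) P v])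
  have cY: "card Y = Suc j" using X v Xn by (simp add: Y_def)
  have downY: "\<forall>u w. (u, w) \<in> A - F \<longrightarrow> w \<in> Y \<longrightarrow> u \<in> Y"
    using down min A(1) by (auto simp: Y_def)
  have leS: "card (S \<inter> UNIV \<times> Y) \<le> card (F \<inter> UNIV \<times> Y)"
  proof -
    have fin: "finite R" using P finite_subset[OF _ A(3), of R] unfolding partial_def by blast
    \<comment> \<open>A newly charged arc enters \<open>v\<close> from an unplaced vertex, so by the
      choice of \<open>v\<close> it belongs to \<open>F\<close>.\<close>
    have "S \<inter> UNIV \<times> Y \<subseteq> (R \<inter> UNIV \<times> X) \<union> (F \<inter> UNIV \<times> {v})"
    proof clarify
      fix u w assume uw: "(u, w) \<in> S" "w \<in> Y" "(u, w) \<notin> F \<inter> UNIV \<times> {v}"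
      show "(u, w) \<in> R \<inter> UNIV \<times> X"
      proof (cases "w = v")
        case True
        have "(u, v) \<in> R" "u \<noteq> v" using uw True v(2) by (auto simp: S_def)
        then have "(u, v) \<in> A - F" "u \<notin> X" using P uw True v(2) by (auto simp: partial_def)
        then show ?thesis using min[of u] A(1) by auto
      next
        case False
        then show ?thesis using uw by (auto simp: S_def Y_def)
      qed
    qed
    then have "card (S \<inter> UNIV \<times> Y) \<le> card ((R \<inter> UNIV \<times> X) \<union> (F \<inter> UNIV \<times> {v}))"
      using fin finF by (intro card_mono) auto
    also have "\<dots> \<le> card (R \<inter> UNIV \<times> X) + card (F \<inter> UNIV \<times> {v})" by (rule card_Un_le)
    also have "\<dots> \<le> card (F \<inter> UNIV \<times> X) + card (F \<inter> UNIV \<times> {v})" using le by simp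
    also have "\<dots> = card ((F \<inter> UNIV \<times> X) \<union> (F \<inter> UNIV \<times> {v}))"
      using finF v(2) by (intro card_Un_disjoint[symmetric]) auto
    also have "(F \<inter> UNIV \<times> X) \<union> (F \<inter> UNIV \<times> {v}) = F \<inter> UNIV \<times> Y" by (auto simp: Y_def)
    finally show ?thesis .
  qed
  have "card (F \<inter> UNIV \<times> Y) \<le> card F" using finF by (intro card_mono) auto
  then have small: "card (S \<inter> UNIV \<times> Y) \<le> k" using leS F(2) by linarith
  have Sn: "S \<subseteq> {..<n} \<times> {..<n}" using PS A(1) by (auto simp: partial_def)
  have "mk n Y S \<in> set (succs (mk n X R) (mk n X R))"
    using v unfolding set_succs_mk Y_def S_def by blast
  then have "(map fst (mk n Y S), Suc k - cost (mk n Y S) (mk n Y S)) \<in> fst ` set (layers matrix (Suc k) (Suc j))"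
    unfolding layers_Suc using e small by (intro expand_complete[OF e]) (auto simp: cost_mk[OF Sn])
  then obtain e' where e': "e' \<in> set (layers matrix (Suc k) (Suc j))"
    "fst e' = (map (\<lambda>u. u \<in> Y) [0..<n], Suc k - card (S \<inter> UNIV \<times> Y))"
    unfolding cost_mk[OF Sn] map_fst_mk by force
  \<comment> \<open>Another state with the same key may have been recorded first.\<close>
  from layers_ok[OF e'(1)] obtain Z Q where Z: "partial n A Z Q" "card Z = Suc j"
    "card (Q \<inter> UNIV \<times> Z) \<le> k"
    "e' = ((map (\<lambda>u. u \<in> Z) [0..<n], Suc k - card (Q \<inter> UNIV \<times> Z)), mk n Z Q)"
    unfolding entry_ok_def by blast
  have "map (\<lambda>u. u \<in> Z) [0..<n] = map (\<lambda>u. u \<in> Y) [0..<n]" using e'(2) Z(4) by simp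
  then have "Z = Y" using map_mem_eq_iff Z(1) PS by (auto simp: partial_def)
  moreover have "Suc k - card (Q \<inter> UNIV \<times> Z) = Suc k - card (S \<inter> UNIV \<times> Y)"
    using e'(2) Z(4) by simp
  then have "card (Q \<inter> UNIV \<times> Z) = card (S \<inter> UNIV \<times> Y)" using Z(3) small by linarith
  ultimately show ?case
    using Z e'(1) downY leS by (intro exI[of _ Y] exI[of _ Q]) auto
qed

text \<open>In the last layer every vertex is placed, so the cost of an entry is the size of all of
  \<open>R\<close>, which is a feedback arc set. An empty last layer contradicts completeness if a
  solution exists.\<close>

lemma answer_correct:
  obtains ans where "correct_FAST_answer A k ans"
    "enc_option (enc_list (enc_list enc_bool)) (answer (layers matrix (Suc k) n)) =
     enc_option (enc_arcs n) ans"
proof (cases "layers matrix (Suc k) n")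
  case Nil
  have "\<not> (\<exists>F. feedback_arc_set A F \<and> card F \<le> k)"
    using layers_complete[of _ n] Nil by fastforce
  then show ?thesis using that[of None] Nil by (simp add: correct_FAST_answer_def answer_def)
next
  case (Cons e L)
  then have "entry_ok n e" by (intro layers_ok) auto
  then obtain X R where XR: "partial n A X R" "card X = n" "card (R \<inter> UNIV \<times> X) \<le> k"
    "snd e = mk n X R" by (auto simp: entry_ok_def)
  have "X = {..<n}" using XR(1,2) by (intro card_subset_eq) (auto simp: partial_def)
  then have "feedback_arc_set A R" "card R \<le> k"
    using partial_final[of n A R] XR A(1) by auto
  moreover have "enc_list (enc_list enc_bool) (map snd (snd e)) = enc_arcs n R"
    by (simp add: XR(4) mk_def enc_arcs_def comp_def)
  ultimately show ?thesis
    using that[of "Some R"] Cons by (simp add: correct_FAST_answer_def answer_def)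
qed

lemma layers_dims: "e \<in> set (layers matrix (Suc k) j) \<Longrightarrow> dims n (snd e)"
  using layers_ok[of e j] by (auto simp: entry_ok_def dims_mk)

end

section \<open>The running time\<close>

text \<open>With all parameters bounded by \<open>S\<close>, insertion is quadratic, expansion of an
  entry cubic and the whole run quintic. The constant is a power of two so that it can later be
  merged into the exponential factor.\<close>

lemma run_time_le:
  fixes S :: nat
  assumes "n \<le> S" "Suc k \<le> S" "l \<le> S"
  shows "(expand_time n (Suc k) l * l + 200) * n + 100 * k + 200 \<le> 2 ^ 11 * S ^ 5"
proof -
  have S: "1 \<le> S" using assms(2) by simp
  have pow: "S ^ i \<le> S ^ j" if "i \<le> j" for i j using S that by (simp add: power_increasing)
  have "add_time n (Suc k) l \<le> (30 * S + 40) * S + 30 * S + (60 * (2 * S + S + 1) + 50) * S + 100"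
    unfolding add_time_def using assms by (intro add_mono mult_mono) auto
  also have "\<dots> = 210 * S ^ 2 + 180 * S ^ 1 + 100 * S ^ 0" by (simp add: power2_eq_square algebra_simps)
  also have "\<dots> \<le> 490 * S ^ 2" using pow[of 1 2] pow[of 0 2] by linarith
  finally have add: "add_time n (Suc k) l \<le> 490 * S ^ 2" .
  have "expand_time n (Suc k) l \<le> (60 * S + 80) * S + (490 * S ^ 2) * S + 60"
    unfolding expand_time_def using assms add by (intro add_mono mult_mono) auto
  also have "\<dots> = 490 * S ^ 3 + 60 * S ^ 2 + 80 * S ^ 1 + 60 * S ^ 0"
    by (simp add: power2_eq_square power3_eq_cube algebra_simps)
  also have "\<dots> \<le> 690 * S ^ 3" using pow[of 2 3] pow[of 1 3] pow[of 0 3] by linarith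
  finally have expand: "expand_time n (Suc k) l \<le> 690 * S ^ 3" .
  have "(expand_time n (Suc k) l * l + 200) * n + 100 * k + 200 \<le>
      (690 * S ^ 3 * S + 200) * S + 100 * S + 200"
    using assms expand by (intro add_mono mult_mono) auto
  also have "\<dots> = 690 * S ^ 5 + 300 * S ^ 1 + 200 * S ^ 0"
  proof -
    have "S ^ 5 = S ^ 3 * S * S" by (simp add: numeral_eq_Suc)
    then show ?thesis by (simp add: algebra_simps)
  qed
  also have "\<dots> \<le> 2 ^ 11 * S ^ 5" using pow[of 1 5] pow[of 0 5] by simp
  finally show ?thesis .
qed

theorem theorem1:
  shows "\<exists>(P :: program) (f :: nat \<Rightarrow> real) (c :: nat).
    f \<in> O(\<lambda>k. sqrt (real k)) \<and>
    (\<forall>(n :: nat) (A :: (nat \<times> nat) set) (k :: nat). tournament {..<n} A \<longrightarrow>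
      (\<exists>ans t. runs P [enc_arcs n A, enc_nat k] (enc_option (enc_arcs n) ans) t \<and>
               correct_FAST_answer A k ans \<and>
               real t \<le> 2 powr f k * real (max 1 n) ^ c))"
proof -
  \<comment> \<open>The successor ensures \<open>m k > 0\<close> also for \<open>k = 0\<close>,
    while \<open>k \<le> m k ^ 2\<close> holds.\<close>
  define m :: "nat \<Rightarrow> nat" where "m k = Suc (nat \<lceil>sqrt (real k)\<rceil>)" for k
  \<comment> \<open>51 is \<open>11 + 5 * 8\<close>: 11 from the constant \<open>2 ^ 11\<close>, as
    \<open>m k\<close> is at least 1, and 8 from each of the five factors \<open>S\<close>.\<close>
  define f :: "nat \<Rightarrow> real" where "f k = 51 * real (m k)" for k
  have m_ge: "sqrt (real k) \<le> real (m k)" and m_le: "real (m k) \<le> sqrt (real k) + 2" for k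
  proof -
    have "real (nat \<lceil>sqrt (real k)\<rceil>) = of_int \<lceil>sqrt (real k)\<rceil>" by simp
    then show "sqrt (real k) \<le> real (m k)" "real (m k) \<le> sqrt (real k) + 2"
      unfolding m_def by linarith+
  qed
  have "f \<in> O(\<lambda>k. sqrt (real k))"
  proof (rule bigoI)
    show "\<forall>\<^sub>F k in at_top. norm (f k) \<le> 153 * norm (sqrt (real k))"
      using eventually_ge_at_top[of 1]
    proof eventually_elim
      case (elim k)
      then have "1 \<le> sqrt (real k)" by simp
      then have "real (m k) \<le> 3 * sqrt (real k)" using m_le[of k] by linarith
      then show ?case by (simp add: f_def)
    qed
  qed
  moreover have "\<exists>ans t. runs prog [enc_arcs n A, enc_nat k] (enc_option (enc_arcs n) ans) t \<and>
      correct_FAST_answer A k ans \<and> real t \<le> 2 powr f k * real (max 1 n) ^ 5"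
    if T: "tournament {..<n} A" for n A k
  proof -
    interpret fast n A k by unfold_locales (rule T)
    define l where "l = 2 ^ (6 * m k) * Suc k"
    \<comment> \<open>The exponent adds 6 for the number of small cuts and 2 for
      \<open>Suc k \<le> 2 ^ (2 * m k)\<close>. The maximum with 1 keeps \<open>S\<close> above
      \<open>l\<close> when \<open>n = 0\<close>.\<close>
    define S where "S = max 1 n * 2 ^ (8 * m k)"
    have m: "0 < m k" by (simp add: m_def)
    have "real k \<le> real (m k) ^ 2" using m_ge[of k] by (metis real_sqrt_ge_0_iff of_nat_0_le_iff power_mono real_sqrt_pow2)
    then have k: "k \<le> m k ^ 2" by (metis of_nat_le_iff of_nat_power)
    have "Suc k \<le> 2 ^ (2 * m k)"
    proof -
      have "m k ^ 2 < (2 ^ m k) ^ 2" by (intro power_strict_mono) auto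
      then show ?thesis using k by (simp add: power_mult[symmetric] mult.commute)
    qed
    then have l: "l \<le> 2 ^ (8 * m k)"
      unfolding l_def using mult_left_mono[of "Suc k" "2 ^ (2 * m k)" "2 ^ (6 * m k)"]
      by (simp add: power_add[symmetric])
    have "Suc k \<le> l" unfolding l_def using mult_right_mono[of 1 "2 ^ (6 * m k)" "Suc k"] by simp
    have S: "2 ^ (8 * m k) \<le> S" by (simp add: S_def)
    have nS: "n \<le> S" unfolding S_def using mult_mono[of n "max 1 n" 1 "2 ^ (8 * m k)"] by simp
    have len: "length matrix = n" by (simp add: matrix_def)
    have "\<exists>t\<le>(expand_time (length matrix) (Suc k) l * l + 200) * length matrix + 100 * k + 200.
      runs prog [enc_list (enc_list enc_bool) matrix, enc_nat k]
        (enc_option (enc_list (enc_list enc_bool)) (answer (layers matrix (Suc k) (length matrix)))) t"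
      by (rule runs_prog) (use length_layers_le[OF m k] layers_dims in \<open>auto simp: len l_def\<close>)
    then obtain t where t: "t \<le> (expand_time n (Suc k) l * l + 200) * n + 100 * k + 200"
      "runs prog [enc_arcs n A, enc_nat k]
        (enc_option (enc_list (enc_list enc_bool)) (answer (layers matrix (Suc k) n))) t"
      unfolding len by (auto simp: enc_arcs_def matrix_def)
    obtain ans where ans: "correct_FAST_answer A k ans"
      "enc_option (enc_list (enc_list enc_bool)) (answer (layers matrix (Suc k) n)) =
       enc_option (enc_arcs n) ans"
      using answer_correct by blast
    have "t \<le> 2 ^ 11 * S ^ 5"
      using t(1) run_time_le[of n S k l] nS l S \<open>Suc k \<le> l\<close> by linarith
    also have "\<dots> \<le> 2 ^ (11 * m k) * S ^ 5" using m by (intro mult_right_mono power_increasing) auto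
    also have "\<dots> = 2 ^ (51 * m k) * max 1 n ^ 5"
      unfolding S_def power_mult_distrib power_mult[symmetric]
      by (simp add: power_add[symmetric])
    finally have "real t \<le> real (2 ^ (51 * m k) * max 1 n ^ 5)" by (simp only: of_nat_le_iff)
    also have "\<dots> = 2 powr f k * real (max 1 n) ^ 5"
    proof -
      have "2 powr f k = (2::real) ^ (51 * m k)" by (simp add: f_def powr_realpow[symmetric])
      then show ?thesis by simp
    qed
    finally show ?thesis using t(2) ans by auto
  qed
  ultimately show ?thesis by blast
qed

end
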